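(* Let $K\ge 2$ and let $L_1,\dots,L_K\ge 1$ be integers. For $\nu>0$ let $T_{(k_1,l_1),(k_2,l_2)}(\nu)$ denote the first-passage time from state $(k_1,l_1)$ to state $(k_2,l_2)$ of the process $(X_t)_{t\ge0}$ with activation rate $\nu$ on the star-shaped state space $\Omega=\{0\}\cup\{(k,l):1\le l\le L_k,\ 1\le k\le K\}$. Let $k_1\ne k_2$ be in $\{1,\dots,K\}$, and set $L_*:=\max_{j\ne k_2}L_j$, $K_*:=\{k\ne k_2: L_k=L_*\}$ and $p_*:=|K_*|L_*/(|K_*|L_*+L_{k_2})$. Then for all integers $0<l_1\le L_{k_1}$ and $0<l_2\le L_{k_2}$, $$\frac{T_{(k_1,l_1),(k_2,l_2)}(\nu)}{\mathbb{E}\,T_{(k_1,l_1),(k_2,l_2)}(\nu)}\xrightarrow{d}\frac{1}{\mathbb{E}M}\sum_{i=1}^{M}Y_i,\qquad \nu\to\infty,$$ where $M$ is distributed as $\mathrm{Geo}(p_* )+I_{\{k_1\in K_*\}}$ and $(Y_i)_{i\ge1}$ are independent exponentially distributed random variables with unit mean, independent of $M$.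
   Context: The process $(X_t)_{t\ge0}$ (with parameter $\nu>0$) is the continuous-time Markov process on $\Omega=\{0\}\cup\{(k,l):1\le l\le L_k,\ 1\le k\le K\}$ whose only nonzero transition rates are $q(0,(k,1))=L_k\nu$; $q((k,l),(k,l+1))=(L_k-l)\nu$ for $l=1,\dots,L_k-1$; $q((k,1),0)=1$; $q((k,l),(k,l-1))=l$ for $l=2,\dots,L_k$; $k=1,\dots,K$. (It arises from a CSMA network on a complete $K$-partite interference graph with component sizes $L_1,\dots,L_K$: state $(k,l)$ means that $l$ nodes are active in component $k$, state $0$ that no node is active.) The first-passage time is $T_{(k_1,l_1),(k_2,l_2)}(\nu)=\inf\{t>0:X_t=(k_2,l_2)\}$ given $X_0=(k_1,l_1)$. $\mathrm{Geo}(p)$ denotes a geometric random variable $N$ on $\{0,1,2,\dots\}$ with $\mathbb{P}\{N=n\}=(1-p)p^n$, so $\mathbb{E}N=p/(1-p)$. $I_{\{\cdot\}}$ is the indicator ($1$ if the condition holds, $0$ otherwise). An empty sum is $0$, and $\xrightarrow{d}$ denotes convergence in distribution. *)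

theory Defs
  imports "HOL-Probability.Probability"
begin

section \<open>Continuous-time Markov processes on a finite state space\<close>

definition transition_function :: "'s set \<Rightarrow> (real \<Rightarrow> 's \<Rightarrow> 's \<Rightarrow> real) \<Rightarrow> bool" where
  "transition_function S p \<longleftrightarrow>
     (\<forall>h\<ge>0. \<forall>x\<in>S. (\<forall>y\<in>S. 0 \<le> p h x y) \<and> (\<Sum>y\<in>S. p h x y) = 1) \<and>
     (\<forall>x\<in>S. \<forall>y\<in>S. p 0 x y = (if x = y then 1 else 0)) \<and>
     (\<forall>s\<ge>0. \<forall>t\<ge>0. \<forall>x\<in>S. \<forall>y\<in>S. p (s + t) x y = (\<Sum>z\<in>S. p s x z * p t z y))"

text \<open>
  Only the off-diagonal values of \<open>q\<close> are used. For finite \<open>S\<close> the rows of a transition function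
  sum to one, so the derivatives at \<open>0\<close> of its diagonal entries are determined by these.
\<close>

definition has_transition_rates ::
  "'s set \<Rightarrow> (real \<Rightarrow> 's \<Rightarrow> 's \<Rightarrow> real) \<Rightarrow> ('s \<Rightarrow> 's \<Rightarrow> real) \<Rightarrow> bool" where
  "has_transition_rates S p q \<longleftrightarrow>
     (\<forall>x\<in>S. \<forall>y\<in>S. x \<noteq> y \<longrightarrow> ((\<lambda>h. p h x y / h) \<longlongrightarrow> q x y) (at_right 0))"

text \<open>
  The Markov property is stated for finite-dimensional cylinder events, in product form, which
  avoids conditioning on events of probability zero.
\<close>

definition markov_property ::
  "'w measure \<Rightarrow> 's set \<Rightarrow> (real \<Rightarrow> 's \<Rightarrow> 's \<Rightarrow> real) \<Rightarrow> (real \<Rightarrow> 'w \<Rightarrow> 's) \<Rightarrow> bool" where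
  "markov_property P S p X \<longleftrightarrow>
     (\<forall>(n::nat) (t :: nat \<Rightarrow> real) (x :: nat \<Rightarrow> 's).
        0 \<le> t 0 \<longrightarrow> (\<forall>i\<le>n. t i < t (Suc i)) \<longrightarrow> (\<forall>i\<le>Suc n. x i \<in> S) \<longrightarrow>
        \<P>(w in P. \<forall>i\<le>Suc n. X (t i) w = x i) =
        \<P>(w in P. \<forall>i\<le>n. X (t i) w = x i) * p (t (Suc n) - t n) (x n) (x (Suc n)))"

text \<open>
  A time-homogeneous Markov process \<open>X\<close> with state space \<open>S\<close>, transition rates \<open>q\<close> and \<open>X 0 = x\<^sub>0\<close>
  almost surely. The paths are right-continuous for the discrete topology, that is, every state
  entered is held for a positive time.
\<close>

definition markov_process ::
  "'w measure \<Rightarrow> 's set \<Rightarrow> ('s \<Rightarrow> 's \<Rightarrow> real) \<Rightarrow> 's \<Rightarrow> (real \<Rightarrow> 'w \<Rightarrow> 's) \<Rightarrow> bool" where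
  "markov_process P S q x\<^sub>0 X \<longleftrightarrow>
     prob_space P \<and> finite S \<and>
     (\<forall>t\<ge>0. X t \<in> P \<rightarrow>\<^sub>M count_space S) \<and>
     (\<forall>w\<in>space P. \<forall>t\<ge>0. \<forall>\<^sub>F s in at_right t. X s w = X t w) \<and>
     (AE w in P. X 0 w = x\<^sub>0) \<and>
     (\<exists>p. transition_function S p \<and> has_transition_rates S p q \<and> markov_property P S p X)"

text \<open>The value is \<open>\<infinity>\<close> on paths that never visit \<open>y\<close> after time \<open>0\<close>.\<close>

definition first_passage_time :: "(real \<Rightarrow> 'w \<Rightarrow> 's) \<Rightarrow> 's \<Rightarrow> 'w \<Rightarrow> ennreal" where
  "first_passage_time X y w = (INF t\<in>{t. 0 < t \<and> X t w = y}. ennreal t)"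


section \<open>The process on the star-shaped state space\<close>

datatype state = Idle | Active nat nat

definition Omega :: "nat \<Rightarrow> (nat \<Rightarrow> nat) \<Rightarrow> state set" where
  "Omega K L = insert Idle {Active k l | k l. k \<in> {1..K} \<and> l \<in> {1..L k}}"

fun rate :: "(nat \<Rightarrow> nat) \<Rightarrow> real \<Rightarrow> state \<Rightarrow> state \<Rightarrow> real" where
  "rate L \<nu> Idle Idle = 0"
| "rate L \<nu> Idle (Active k l) = (if l = 1 then real (L k) * \<nu> else 0)"
| "rate L \<nu> (Active k l) Idle = (if l = 1 then 1 else 0)"
| "rate L \<nu> (Active k l) (Active k' l') =
     (if k' = k \<and> l' = l + 1 then (real (L k) - real l) * \<nu>
      else if k' = k \<and> l = l' + 1 then real l
      else 0)"


section \<open>Convergence in distribution and the limit law\<close>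

text \<open>
  This is \<^const>\<open>weak_conv_m\<close>, with an arbitrary filter in place of
  \<^const>\<open>sequentially\<close>.
\<close>

definition weak_conv_filter :: "('i \<Rightarrow> real measure) \<Rightarrow> real measure \<Rightarrow> 'i filter \<Rightarrow> bool" where
  "weak_conv_filter \<mu> \<mu>\<^sub>0 F \<longleftrightarrow>
     (\<forall>x. isCont (cdf \<mu>\<^sub>0) x \<longrightarrow> ((\<lambda>i. cdf (\<mu> i) x) \<longlongrightarrow> cdf \<mu>\<^sub>0 x) F)"

definition L_star :: "nat \<Rightarrow> (nat \<Rightarrow> nat) \<Rightarrow> nat \<Rightarrow> nat" where
  "L_star K L k\<^sub>2 = Max (L ` ({1..K} - {k\<^sub>2}))"

definition K_star :: "nat \<Rightarrow> (nat \<Rightarrow> nat) \<Rightarrow> nat \<Rightarrow> nat set" where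
  "K_star K L k\<^sub>2 = {k \<in> {1..K} - {k\<^sub>2}. L k = L_star K L k\<^sub>2}"

definition p_star :: "nat \<Rightarrow> (nat \<Rightarrow> nat) \<Rightarrow> nat \<Rightarrow> real" where
  "p_star K L k\<^sub>2 =
     real (card (K_star K L k\<^sub>2) * L_star K L k\<^sub>2) /
     real (card (K_star K L k\<^sub>2) * L_star K L k\<^sub>2 + L k\<^sub>2)"

text \<open>
  The library's \<^const>\<open>geometric_pmf\<close> is parametrised by the success
  probability, whereas \<open>Geo p\<close> gives mass \<open>(1 - p) p\<^sup>n\<close> to \<open>n\<close>.
\<close>

definition Geo :: "real \<Rightarrow> nat pmf" where
  "Geo p = geometric_pmf (1 - p)"

lemma pmf_Geo: "0 \<le> p \<Longrightarrow> p < 1 \<Longrightarrow> pmf (Geo p) n = (1 - p) * p ^ n"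
  by (simp add: Geo_def)

end

theory Submission
  imports Defs
begin

text \<open>
  Each departure from the idle state either enters branch \<open>k\<^sub>2\<close> or starts an excursion into another
  branch, which delays the passage. An excursion into branch \<open>k\<close> typically reaches its top; it then lasts
  about \<open>\<nu>^(L k - 1) / L k\<close> and is asymptotically exponential, because the chain forgets its position in
  the branch long before it escapes. On the time scale \<open>\<nu>^(L\<^sub>* - 1)\<close> only excursions into the branches in
  \<open>K\<^sub>*\<close> take time. A departure into one of these or into branch \<open>k\<^sub>2\<close> goes to \<open>K\<^sub>*\<close> with probability \<open>p\<^sub>*\<close>,
  and once branch \<open>k\<^sub>2\<close> is entered, the climb to \<open>l\<^sub>2\<close> is immediate. So the passage takes a geometric
  number of exponential excursions, and one more if the chain starts in a branch of \<open>K\<^sub>*\<close>.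

  The proof works with Laplace transforms instead of excursions. For every \<open>s > 0\<close> the numbers
  \<open>f(x) = E\<^sub>x exp(-s T)\<close> satisfy \<open>s f(x) = \<Sum>\<^sub>z q(x,z) (f(z) - f(x))\<close> away from the target, where
  \<open>f = 1\<close>. As the process is given from a single starting state and only through its finite-dimensional
  laws, this system is obtained by sampling on a time grid, where first-step equations are pure
  linear algebra, and passing to a limit along a subsequence (\<open>first_passage_transform\<close>). Only the
  existence of one solution with values in \<open>[0,1]\<close> and the right value at the start is needed.

  Along a branch the system is a birth-and-death recursion with reversible weights
  \<open>\<pi>\<^sub>j = (L choose j) \<nu>^j\<close>. Summing it against these weights gives the differences of \<open>f\<close> as \<open>s\<close> times
  explicit positive combinations of values of \<open>f\<close> (\<open>star_passage\<close>). These identities do everything: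
  letting \<open>s\<close> tend to \<open>0\<close> makes \<open>f\<close> tend to \<open>1\<close> and yields the exact mean \<open>E T\<close> (\<open>mean_passage_time\<close>);
  for large \<open>\<nu>\<close> only the terms of weight \<open>\<nu>^L\<^sub>*\<close> survive, and a two-unknown linear system remains, with
  the idle state and the tops of the dominant branches as unknowns (\<open>transform_limit\<close>,
  \<open>mean_limit\<close>). Its solution is the transform of the geometric sum
  (\<open>random_sum_laplace\<close>, \<open>geometric_generating\<close>).

  Finally \<open>E exp(-n V)\<close> is the \<open>n\<close>-th moment of \<open>exp(-V)\<close>, a variable in \<open>[0,1]\<close>, so convergence of
  these numbers for natural \<open>n\<close> already forces weak convergence, by polynomial approximation
  (\<open>laplace_imp_weak_conv\<close>).
\<close>

section \<open>Avoiding a state on a time grid\<close>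

text \<open>
  The probability that a chain with one-step kernel \<open>A\<close>, started in \<open>x\<close>, avoids \<open>y\<close> in the steps \<open>1\<close>
  to \<open>n\<close>. The starting point itself is not tested, so for \<open>x = y\<close> it concerns the first return.
\<close>

primrec survival :: "('s \<Rightarrow> 's \<Rightarrow> real) \<Rightarrow> 's set \<Rightarrow> 's \<Rightarrow> nat \<Rightarrow> 's \<Rightarrow> real" where
  "survival A S y 0 x = 1"
| "survival A S y (Suc n) x = (\<Sum>z\<in>S - {y}. A x z * survival A S y n z)"

lemma survival_bounds:
  assumes "finite S" "x \<in> S" "\<forall>x\<in>S. (\<forall>z\<in>S. 0 \<le> A x z) \<and> (\<Sum>z\<in>S. A x z) = 1"
  shows "0 \<le> survival A S y n x \<and> survival A S y n x \<le> 1"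
  using assms(2)
proof (induction n arbitrary: x)
  case (Suc n)
  have "(\<Sum>z\<in>S - {y}. A x z * survival A S y n z) \<le> (\<Sum>z\<in>S - {y}. A x z)"
    using Suc assms(3) by (intro sum_mono mult_left_le) auto
  also have "\<dots> \<le> (\<Sum>z\<in>S. A x z)"
    using Suc assms by (intro sum_mono2) auto
  finally show ?case
    using Suc assms(3) by (auto intro!: sum_nonneg)
qed auto

lemma sets_Collect_all_le:
  fixes n :: nat
  assumes "\<And>i. i \<le> n \<Longrightarrow> {w \<in> space P. Q i w} \<in> sets P"
  shows "{w \<in> space P. \<forall>i\<le>n. Q i w} \<in> sets P"
proof -
  have "{w \<in> space P. \<forall>i\<in>{..n}. Q i w} \<in> sets P"
    using assms by (intro sets.sets_Collect_finite_All') auto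
  then show ?thesis by (simp only: Ball_def atMost_iff)
qed

text \<open>
  The Markov property speaks of single trajectories; finiteness of the state space allows summing it
  over all trajectories through given sets.
\<close>

lemma markov_cylinder:
  fixes t :: "nat \<Rightarrow> real"
  assumes P: "prob_space P" and S: "finite S" and X: "\<And>t. t \<ge> 0 \<Longrightarrow> X t \<in> P \<rightarrow>\<^sub>M count_space S"
    and mp: "markov_property P S p X"
    and t: "0 \<le> t 0" "\<And>i. i \<le> n \<Longrightarrow> t i < t (Suc i)" and B: "\<And>i. i \<le> n \<Longrightarrow> B i \<subseteq> S"
    and u: "u \<in> S" and v: "v \<in> S"
  shows "\<P>(w in P. ((\<forall>i\<le>n. X (t i) w \<in> B i) \<and> X (t n) w = u) \<and> X (t (Suc n)) w = v) =
         \<P>(w in P. (\<forall>i\<le>n. X (t i) w \<in> B i) \<and> X (t n) w = u) * p (t (Suc n) - t n) u v"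
proof -
  interpret prob_space P by fact
  have tpos: "0 \<le> t i" if "i \<le> Suc n" for i
    using that by (induction i) (use t in \<open>auto intro: order_trans less_imp_le\<close>)
  define Z where "Z = {x \<in> PiE {..n} B. x n = u}"
  have finB: "finite (B i)" if "i \<le> n" for i using B[OF that] S finite_subset by blast
  have fin: "finite Z"
    unfolding Z_def by (rule finite_subset[of _ "PiE {..n} B"]) (auto intro!: finite_PiE finB)
  have ZB: "x i \<in> B i" "x n = u" if "x \<in> Z" "i \<le> n" for x i
    using that by (auto simp: Z_def PiE_def Pi_def)
  have ev: "{w\<in>space P. X (t i) w = a} \<in> events" if "i \<le> Suc n" for i a
  proof (cases "a \<in> S")
    case True
    have "X (t i) -` {a} \<inter> space P \<in> events"
      using True by (intro measurable_sets[OF X]) (auto simp: tpos that)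
    then show ?thesis by (simp add: vimage_def Int_def conj_commute)
  next
    case False
    have "{w\<in>space P. X (t i) w = a} = {}"
      using False measurable_space[OF X[OF tpos[OF that]]] by auto
    then show ?thesis by (simp only: sets.empty_sets)
  qed
  have evB: "{w\<in>space P. X (t i) w \<in> C} \<in> events" if "i \<le> Suc n" "C \<subseteq> S" for i C
  proof -
    have "X (t i) -` C \<inter> space P \<in> events"
      using that by (intro measurable_sets[OF X]) (auto simp: tpos)
    then show ?thesis by (simp add: vimage_def Int_def conj_commute)
  qed
  have evZ: "{w\<in>space P. \<forall>i\<le>n. X (t i) w = x i} \<in> events" for x
    by (intro sets_Collect_all_le ev) auto
  have evBn: "{w\<in>space P. (\<forall>i\<le>n. X (t i) w \<in> B i) \<and> X (t n) w = u} \<in> events"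
    by (intro sets.sets_Collect_conj sets_Collect_all_le ev) (auto simp: evB B)
  have ex1: "\<exists>!x. x \<in> Z \<and> (\<forall>i\<le>n. X (t i) w = x i)"
    if "\<forall>i\<le>n. X (t i) w \<in> B i" "X (t n) w = u" for w
  proof (intro ex1I[of _ "restrict (\<lambda>i. X (t i) w) {..n}"] conjI)
    fix x assume "x \<in> Z \<and> (\<forall>i\<le>n. X (t i) w = x i)"
    then show "x = restrict (\<lambda>i. X (t i) w) {..n}"
      by (intro ext) (auto simp: Z_def PiE_def extensional_def restrict_def)
  qed (use that in \<open>auto simp: Z_def\<close>)
  have sum1: "\<P>(w in P. (\<forall>i\<le>n. X (t i) w \<in> B i) \<and> X (t n) w = u) =
      (\<Sum>x\<in>Z. \<P>(w in P. \<forall>i\<le>n. X (t i) w = x i))"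
  proof (rule prob_sum[OF fin evZ evBn], rule AE_I2, intro conjI ballI impI)
    fix x w assume "x \<in> Z" "\<forall>i\<le>n. X (t i) w = x i"
    then show "\<forall>i\<le>n. X (t i) w \<in> B i" "X (t n) w = u"
      using ZB by (simp, metis order_refl)
  next
    fix w assume "(\<forall>i\<le>n. X (t i) w \<in> B i) \<and> X (t n) w = u"
    then show "\<exists>!x. x \<in> Z \<and> (\<forall>i\<le>n. X (t i) w = x i)"
      by (intro ex1) simp_all
  qed
  have sum2: "\<P>(w in P. ((\<forall>i\<le>n. X (t i) w \<in> B i) \<and> X (t n) w = u) \<and> X (t (Suc n)) w = v) =
      (\<Sum>x\<in>Z. \<P>(w in P. (\<forall>i\<le>n. X (t i) w = x i) \<and> X (t (Suc n)) w = v))"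
  proof (rule prob_sum[OF fin])
    show "{w\<in>space P. (\<forall>i\<le>n. X (t i) w = x i) \<and> X (t (Suc n)) w = v} \<in> events" for x
      by (intro sets.sets_Collect_conj evZ ev) simp
    show "{w\<in>space P. ((\<forall>i\<le>n. X (t i) w \<in> B i) \<and> X (t n) w = u) \<and> X (t (Suc n)) w = v} \<in> events"
      by (intro sets.sets_Collect_conj evBn ev) simp
    show "AE w in P. (\<forall>x\<in>Z. (\<forall>i\<le>n. X (t i) w = x i) \<and> X (t (Suc n)) w = v \<longrightarrow>
        ((\<forall>i\<le>n. X (t i) w \<in> B i) \<and> X (t n) w = u) \<and> X (t (Suc n)) w = v) \<and>
      (((\<forall>i\<le>n. X (t i) w \<in> B i) \<and> X (t n) w = u) \<and> X (t (Suc n)) w = v \<longrightarrow>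
        (\<exists>!x. x \<in> Z \<and> (\<forall>i\<le>n. X (t i) w = x i) \<and> X (t (Suc n)) w = v))"
    proof (intro AE_I2 conjI ballI impI)
      fix x w assume "x \<in> Z" "(\<forall>i\<le>n. X (t i) w = x i) \<and> X (t (Suc n)) w = v"
      then show "\<forall>i\<le>n. X (t i) w \<in> B i" "X (t n) w = u" "X (t (Suc n)) w = v"
        using ZB by (simp, metis order_refl, blast)
    next
      fix w assume "((\<forall>i\<le>n. X (t i) w \<in> B i) \<and> X (t n) w = u) \<and> X (t (Suc n)) w = v"
      then show "\<exists>!x. x \<in> Z \<and> (\<forall>i\<le>n. X (t i) w = x i) \<and> X (t (Suc n)) w = v"
        using ex1[of w] by simp
    qed
  qed
  have "\<P>(w in P. (\<forall>i\<le>n. X (t i) w = x i) \<and> X (t (Suc n)) w = v) =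
      \<P>(w in P. \<forall>i\<le>n. X (t i) w = x i) * p (t (Suc n) - t n) u v" if x: "x \<in> Z" for x
  proof -
    define x' where "x' = x(Suc n := v)"
    have "\<forall>i\<le>Suc n. x' i \<in> S"
      using x B v by (auto simp: x'_def Z_def PiE_def Pi_def le_Suc_eq)
    then have "\<P>(w in P. \<forall>i\<le>Suc n. X (t i) w = x' i) =
        \<P>(w in P. \<forall>i\<le>n. X (t i) w = x' i) * p (t (Suc n) - t n) (x' n) (x' (Suc n))"
      using mp t unfolding markov_property_def by blast
    moreover have "(\<forall>i\<le>Suc n. X (t i) w = x' i) \<longleftrightarrow> (\<forall>i\<le>n. X (t i) w = x i) \<and> X (t (Suc n)) w = v" for w
      by (auto simp: x'_def le_Suc_eq)
    moreover have "(\<forall>i\<le>n. X (t i) w = x' i) \<longleftrightarrow> (\<forall>i\<le>n. X (t i) w = x i)" for w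
      by (auto simp: x'_def)
    ultimately show ?thesis using x by (simp add: x'_def Z_def)
  qed
  note step = this
  show ?thesis unfolding sum1 sum2 sum_distrib_right by (intro sum.cong refl step)
qed

text \<open>
  The process is only given from \<open>x\<^sub>0\<close>, whereas \<open>survival\<close> recurses over the starting point. The two
  are reconciled by pairing the law \<open>R n\<close> of the position after \<open>n\<close> successful steps (forward in
  time) with \<open>survival\<close> (backward in time): the pairing depends only on the total number of steps.
\<close>

lemma markov_survival:
  assumes P: "prob_space P" and S: "finite S" and X: "\<And>t. t \<ge> 0 \<Longrightarrow> X t \<in> P \<rightarrow>\<^sub>M count_space S"
    and mp: "markov_property P S p X" and x0: "AE w in P. X 0 w = x0" "x0 \<in> S" "x0 \<noteq> y"
    and h: "0 < h"
  shows "\<P>(w in P. \<forall>i\<in>{1..n}. X (real i * h) w \<noteq> y) = survival (p h) S y n x0"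
proof -
  interpret prob_space P by fact
  define R where "R n z = \<P>(w in P. (\<forall>i\<le>n. X (real i * h) w \<in> S - {y}) \<and> X (real n * h) w = z)" for n z
  have ev: "{w\<in>space P. X (real i * h) w \<in> C} \<in> events" if "C \<subseteq> S" for i C
  proof -
    have "X (real i * h) -` C \<inter> space P \<in> events"
      using that h by (intro measurable_sets[OF X]) auto
    then show ?thesis by (simp add: vimage_def Int_def conj_commute)
  qed
  have inS: "X (real i * h) w \<in> S" if "w \<in> space P" for i w
    using measurable_space[OF X, of "real i * h" w] that h by simp
  have evA: "{w\<in>space P. \<forall>i\<le>n. X (real i * h) w \<in> S - {y}} \<in> events" for n
    by (intro sets_Collect_all_le ev) auto
  have ev1: "{w\<in>space P. X (real i * h) w = z} \<in> events" if "z \<in> S" for i z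
    using ev[of "{z}" i] that by simp
  have evR: "{w\<in>space P. (\<forall>i\<le>n. X (real i * h) w \<in> S - {y}) \<and> X (real n * h) w = z} \<in> events"
    if "z \<in> S" for n z
    by (intro sets.sets_Collect_conj evA ev1 that)
  have R0: "R 0 z = (if z = x0 then 1 else 0)" if "z \<in> S" for z
  proof -
    have "R 0 z = \<P>(w in P. z = x0)"
      unfolding R_def
    proof (intro prob_eq_AE evR that)
      show "AE w in P. ((\<forall>i\<le>0. X (real i * h) w \<in> S - {y}) \<and> X (real 0 * h) w = z) = (z = x0)"
        using x0(1) by eventually_elim (use x0 in auto)
    qed simp
    then show ?thesis by (simp add: prob_space)
  qed
  have RS: "R (Suc n) z = (\<Sum>u\<in>S - {y}. R n u * p h u z)" if z: "z \<in> S - {y}" for n z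
  proof -
    have "R (Suc n) z = (\<Sum>u\<in>S - {y}. \<P>(w in P. ((\<forall>i\<le>n. X (real i * h) w \<in> S - {y}) \<and>
        X (real n * h) w = u) \<and> X (real (Suc n) * h) w = z))"
      unfolding R_def
    proof (rule prob_sum)
      show "{w\<in>space P. ((\<forall>i\<le>n. X (real i * h) w \<in> S - {y}) \<and>
        X (real n * h) w = u) \<and> X (real (Suc n) * h) w = z} \<in> events" if "u \<in> S - {y}" for u
        using that z by (intro sets.sets_Collect_conj evR ev1) (simp_all only: Diff_iff)
      show "AE w in P. (\<forall>u\<in>S - {y}. ((\<forall>i\<le>n. X (real i * h) w \<in> S - {y}) \<and>
          X (real n * h) w = u) \<and> X (real (Suc n) * h) w = z \<longrightarrow>
          (\<forall>i\<le>Suc n. X (real i * h) w \<in> S - {y}) \<and> X (real (Suc n) * h) w = z) \<and>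
        ((\<forall>i\<le>Suc n. X (real i * h) w \<in> S - {y}) \<and> X (real (Suc n) * h) w = z \<longrightarrow>
          (\<exists>!u. u \<in> S - {y} \<and> ((\<forall>i\<le>n. X (real i * h) w \<in> S - {y}) \<and>
            X (real n * h) w = u) \<and> X (real (Suc n) * h) w = z))"
        using z by (intro AE_I2) (auto simp only: Diff_iff le_Suc_eq singleton_iff)
    next
      show "finite (S - {y})" using S by simp
      show "{w\<in>space P. (\<forall>i\<le>Suc n. X (real i * h) w \<in> S - {y}) \<and> X (real (Suc n) * h) w = z} \<in> events"
        using z by (intro evR) simp
    qed
    also have "\<dots> = (\<Sum>u\<in>S - {y}. R n u * p h u z)"
    proof (intro sum.cong refl)
      fix u assume u: "u \<in> S - {y}"
      have "\<P>(w in P. ((\<forall>i\<le>n. X (real i * h) w \<in> S - {y}) \<and>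
          X (real n * h) w = u) \<and> X (real (Suc n) * h) w = z) = R n u * p (real (Suc n) * h - real n * h) u z"
        unfolding R_def
        by (rule markov_cylinder[OF P S X mp]) (use u z h in auto)
      then show "\<P>(w in P. ((\<forall>i\<le>n. X (real i * h) w \<in> S - {y}) \<and>
        X (real n * h) w = u) \<and> X (real (Suc n) * h) w = z) = R n u * p h u z"
        by (simp add: algebra_simps)
    qed
    finally show ?thesis .
  qed
  \<comment> \<open>Both ends of this identity are used: at \<open>n = 0\<close> the law \<open>R 0\<close> is a point mass at \<open>x\<^sub>0\<close>,
      at \<open>m = 0\<close> the survival factor is \<open>1\<close>.\<close>
  have flow: "(\<Sum>z\<in>S - {y}. R n z * survival (p h) S y m z) = survival (p h) S y (n + m) x0" for n m
  proof (induction n arbitrary: m)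
    case 0
    have "(\<Sum>z\<in>S - {y}. R 0 z * survival (p h) S y m z) =
        (\<Sum>z\<in>S - {y}. if z = x0 then survival (p h) S y m z else 0)"
      by (intro sum.cong) (auto simp: R0)
    then show ?case using S x0 by simp
  next
    case (Suc n)
    have "(\<Sum>z\<in>S - {y}. R (Suc n) z * survival (p h) S y m z) =
        (\<Sum>z\<in>S - {y}. \<Sum>u\<in>S - {y}. R n u * (p h u z * survival (p h) S y m z))"
      by (intro sum.cong refl) (simp add: RS sum_distrib_right mult.assoc)
    also have "\<dots> = (\<Sum>u\<in>S - {y}. R n u * survival (p h) S y (Suc m) u)"
      by (subst sum.swap) (simp add: sum_distrib_left)
    finally show ?case using Suc.IH[of "Suc m"] by simp
  qed
  have "\<P>(w in P. \<forall>i\<in>{1..n}. X (real i * h) w \<noteq> y) = \<P>(w in P. \<forall>i\<le>n. X (real i * h) w \<in> S - {y})"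
  proof (rule prob_eq_AE)
    show "AE w in P. (\<forall>i\<in>{1..n}. X (real i * h) w \<noteq> y) = (\<forall>i\<le>n. X (real i * h) w \<in> S - {y})"
      using x0(1) AE_space
    proof eventually_elim
      case (elim w)
      have "(\<forall>i\<in>{1..n}. X (real i * h) w \<noteq> y) = (\<forall>i\<in>{0..n}. X (real i * h) w \<noteq> y)"
        using elim x0(3) by (auto simp: Ball_def) (metis Suc_leI gr_zeroI mult_zero_left of_nat_0)
      then show ?case using inS elim by auto
    qed
    have "{w\<in>space P. \<forall>i\<in>{1..n}. X (real i * h) w \<noteq> y} = {w\<in>space P. \<forall>i\<in>{1..n}. X (real i * h) w \<in> S - {y}}"
      using inS by auto
    also have "\<dots> \<in> events" by (intro sets.sets_Collect_finite_All ev) auto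
    finally show "{w\<in>space P. \<forall>i\<in>{1..n}. X (real i * h) w \<noteq> y} \<in> events" .
  qed (rule evA)
  also have "\<dots> = (\<Sum>z\<in>S - {y}. R n z)"
    unfolding R_def
  proof (rule prob_sum)
    show "AE w in P. (\<forall>z\<in>S - {y}. (\<forall>i\<le>n. X (real i * h) w \<in> S - {y}) \<and> X (real n * h) w = z \<longrightarrow>
          (\<forall>i\<le>n. X (real i * h) w \<in> S - {y})) \<and>
        ((\<forall>i\<le>n. X (real i * h) w \<in> S - {y}) \<longrightarrow>
          (\<exists>!z. z \<in> S - {y} \<and> (\<forall>i\<le>n. X (real i * h) w \<in> S - {y}) \<and> X (real n * h) w = z))"
      by (intro AE_I2) auto
    show "{w\<in>space P. (\<forall>i\<le>n. X (real i * h) w \<in> S - {y}) \<and> X (real n * h) w = z} \<in> events"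
      if "z \<in> S - {y}" for z using that by (intro evR) simp
    show "{w\<in>space P. \<forall>i\<le>n. X (real i * h) w \<in> S - {y}} \<in> events" by (rule evA)
    show "finite (S - {y})" using S by simp
  qed
  also have "\<dots> = survival (p h) S y n x0" using flow[of n 0] by simp
  finally show ?thesis .
qed

section \<open>The Laplace transform of a first-passage time\<close>

text \<open>
  The function \<open>exp(-s t)\<close> on extended times. The value at \<open>\<infinity>\<close> has to be set by hand, because
  \<^const>\<open>enn2real\<close> maps \<open>\<infinity>\<close> to \<open>0\<close>.
\<close>

definition exp_decay :: "real \<Rightarrow> ennreal \<Rightarrow> real" where
  "exp_decay s t = (if t = \<infinity> then 0 else exp (- s * enn2real t))"

lemma exp_decay_measurable [measurable]: "exp_decay s \<in> borel_measurable borel"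
  unfolding exp_decay_def by measurable

lemma exp_decay_bounds: "0 \<le> s \<Longrightarrow> 0 \<le> exp_decay s t \<and> exp_decay s t \<le> 1"
  by (auto simp: exp_decay_def)

lemma finite_family_convergent_subsequence:
  fixes f :: "nat \<Rightarrow> 'a \<Rightarrow> real"
  assumes "finite S" "\<And>n x. x \<in> S \<Longrightarrow> \<bar>f n x\<bar> \<le> C"
  obtains r g where "strict_mono r" "\<And>x. x \<in> S \<Longrightarrow> (\<lambda>n. f (r n) x) \<longlonglongrightarrow> g x"
proof -
  have "\<exists>r g. strict_mono (r :: nat \<Rightarrow> nat) \<and> (\<forall>x\<in>S. (\<lambda>n. f (r n) x) \<longlonglongrightarrow> g x)"
    using assms
  proof (induction S rule: finite_induct)
    case empty
    then show ?case by (auto intro!: exI[of _ id] strict_mono_id)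
  next
    case (insert a S)
    then obtain r g where r: "strict_mono (r :: nat \<Rightarrow> nat)"
      and g: "\<And>x. x \<in> S \<Longrightarrow> (\<lambda>n. f (r n) x) \<longlonglongrightarrow> g x"
      by (metis insertCI)
    have "bounded (range (\<lambda>n. f (r n) a))"
      unfolding bounded_iff using insert.prems by (auto intro!: exI[of _ C])
    then obtain l r' where r': "strict_mono (r' :: nat \<Rightarrow> nat)" and l: "((\<lambda>n. f (r n) a) \<circ> r') \<longlonglongrightarrow> l"
      using bounded_imp_convergent_subsequence by blast
    show ?case
    proof (intro exI conjI ballI)
      show "strict_mono (r \<circ> r')" using r r' by (rule strict_mono_o)
      fix x assume "x \<in> insert a S"
      then show "(\<lambda>n. f ((r \<circ> r') n) x) \<longlonglongrightarrow> (g(a := l)) x"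
        using l LIMSEQ_subseq_LIMSEQ[OF g r', of x] insert.hyps by (auto simp: o_def)
    qed
  qed
  then show ?thesis using that by blast
qed

text \<open>
  Here \<open>A\<close> is the set of times at which a path occupies the target, and the sum is \<open>1 - q^N\<close> for the
  first grid index \<open>N\<close> with \<open>N h \<in> A\<close>. Grid times in \<open>A\<close> are never earlier than the infimum of
  \<open>A\<close>, and since \<open>A\<close> contains an interval to the right of each of its points, fine grids hit it
  soon after.
\<close>

lemma sampled_decay_tendsto:
  fixes A :: "real set"
  assumes A: "\<And>t. t \<in> A \<Longrightarrow> 0 < t" and hold: "\<And>t. t \<in> A \<Longrightarrow> \<exists>\<delta>>0. {t..<t+\<delta>} \<subseteq> A"
    and s: "0 < s"
  defines "q \<equiv> \<lambda>m. exp (- s / real (Suc m))"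
  shows "(\<lambda>m. \<Sum>n. (1 - q m) * q m ^ n * (if \<forall>i\<in>{1..n}. real i * (1 / real (Suc m)) \<notin> A then 1 else 0))
           \<longlonglongrightarrow> 1 - exp_decay s (INF t\<in>A. ennreal t)"
proof -
  define D where "D m = (\<Sum>n. (1 - q m) * q m ^ n *
    (if \<forall>i\<in>{1..n}. real i * (1 / real (Suc m)) \<notin> A then 1 else 0))" for m
  define T where "T = (INF t\<in>A. ennreal t)"
  have q: "0 < q m" "q m < 1" for m using s by (auto simp: q_def)
  have q_pow: "q m ^ n = exp (- s * (real n * (1 / real (Suc m))))" for m n
    by (simp add: q_def exp_of_nat_mult[symmetric] field_simps)
  show ?thesis
  proof (cases "A = {}")
    case True
    then have "D m = 1" for m
      using geometric_sums[of "q m"] q[of m] by (auto simp: D_def sums_iff suminf_mult)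
    then have "D \<longlonglongrightarrow> 1" by (auto intro: tendsto_eventually)
    then show ?thesis using True unfolding D_def[abs_def] by (simp add: exp_decay_def)
  next
    case False
    then obtain t0 where t0: "t0 \<in> A" by auto
    have "T \<le> ennreal t0" unfolding T_def by (rule INF_lower[OF t0])
    then have Tfin: "T \<noteq> \<infinity>" by (auto simp: top_unique)
    define \<tau> where "\<tau> = enn2real T"
    have T: "T = ennreal \<tau>" using Tfin by (simp add: \<tau>_def less_top)
    have \<tau>_le: "\<tau> \<le> t" if "t \<in> A" for t
    proof -
      have "ennreal \<tau> \<le> ennreal t" using INF_lower[OF that, of ennreal] T by (simp add: T_def)
      then show ?thesis using A[OF that] by (simp add: ennreal_le_iff)
    qed
    have \<tau>_approx: "\<exists>t\<in>A. t < \<tau> + e" if "0 < e" for e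
    proof -
      have "T < ennreal (\<tau> + e)" unfolding T using that by (intro ennreal_lessI) (auto simp: \<tau>_def add_nonneg_pos)
      then obtain t where "t \<in> A" "ennreal t < ennreal (\<tau> + e)" unfolding T_def INF_less_iff by auto
      then show ?thesis using A[of t] by (auto simp: ennreal_less_iff)
    qed
    have partial: "(\<Sum>n<N. (1 - q m) * q m ^ n) = 1 - q m ^ N" for N m
      by (simp only: sum_distrib_left[symmetric] sum_gp_strict) (use q[of m] in simp)
    have summ: "summable (\<lambda>n. (1 - q m) * q m ^ n)" for m
      using q[of m] by (intro summable_mult summable_geometric) auto
    have summ': "summable (\<lambda>n. (1 - q m) * q m ^ n * (if P n then 1 else 0))" for m P
      by (rule summable_comparison_test'[OF summ[of m], of 0]) (use q[of m] in auto)
    have upper: "D m \<le> 1 - q m ^ N" if "N \<ge> 1" "real N * (1 / real (Suc m)) \<in> A" for m N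
    proof -
      have "D m \<le> (\<Sum>n. (1 - q m) * q m ^ n * (if n < N then 1 else 0))"
        unfolding D_def
      proof (intro suminf_le summ' mult_left_mono)
        fix n show "(if \<forall>i\<in>{1..n}. real i * (1 / real (Suc m)) \<notin> A then 1 else 0::real) \<le> (if n < N then 1 else 0)"
          using that by force
        show "0 \<le> (1 - q m) * q m ^ n" using q[of m] by simp
      qed
      also have "\<dots> = (\<Sum>n<N. (1 - q m) * q m ^ n * (if n < N then 1 else 0))"
        by (rule suminf_finite) auto
      also have "\<dots> = 1 - q m ^ N" by (simp add: partial[symmetric])
      finally show ?thesis .
    qed
    have lower: "1 - exp (- s * \<tau>) \<le> D m" for m
    proof -
      define N where "N = nat \<lceil>\<tau> * real (Suc m)\<rceil>"
      have \<tau>0: "0 \<le> \<tau>" by (simp add: \<tau>_def)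
      have N1: "\<tau> \<le> real N * (1 / real (Suc m))"
        unfolding N_def using real_nat_ceiling_ge[of "\<tau> * real (Suc m)"] by (simp add: field_simps del: of_nat_Suc)
      have N2: "real i * (1 / real (Suc m)) \<notin> A" if "i < N" for i
      proof
        assume "real i * (1 / real (Suc m)) \<in> A"
        then have "\<tau> * real (Suc m) \<le> real i" using \<tau>_le by (force simp: field_simps)
        then have "N \<le> i" unfolding N_def by (simp add: ceiling_le_iff nat_le_iff del: of_nat_Suc)
        then show False using that by simp
      qed
      have "1 - exp (- s * \<tau>) \<le> 1 - q m ^ N"
        unfolding q_pow using mult_left_mono[OF N1, of s] s by simp
      also have "\<dots> = (\<Sum>n<N. (1 - q m) * q m ^ n * (if n < N then 1 else 0))"
        by (simp add: partial[symmetric])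
      also have "\<dots> = (\<Sum>n. (1 - q m) * q m ^ n * (if n < N then 1 else 0))"
        by (rule suminf_finite[symmetric]) auto
      also have "\<dots> \<le> D m"
        unfolding D_def
      proof (intro suminf_le summ' mult_left_mono)
        fix n show "(if n < N then 1 else 0::real) \<le> (if \<forall>i\<in>{1..n}. real i * (1 / real (Suc m)) \<notin> A then 1 else 0)"
          using N2 by auto
        show "0 \<le> (1 - q m) * q m ^ n" using q[of m] by simp
      qed
      finally show ?thesis .
    qed
    have ev: "eventually (\<lambda>m. D m \<le> 1 - exp (- s * (\<tau> + e))) sequentially" if e: "0 < e" for e
    proof -
      obtain t where t: "t \<in> A" "t < \<tau> + e" using \<tau>_approx[OF e] by auto
      obtain \<delta> where \<delta>: "0 < \<delta>" "{t..<t+\<delta>} \<subseteq> A" using hold[OF t(1)] by auto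
      have "eventually (\<lambda>m. 1 / real (Suc m) < min \<delta> (\<tau> + e - t)) sequentially"
        using LIMSEQ_inverse_real_of_nat t \<delta>
        by (intro order_tendstoD[of _ 0]) (auto simp: inverse_eq_divide)
      then show ?thesis
      proof eventually_elim
        case (elim m)
        define N where "N = nat \<lceil>t * real (Suc m)\<rceil>"
        have tpos: "0 < t * real (Suc m)" using A[OF t(1)] by simp
        have N1: "N \<ge> 1" unfolding N_def using tpos by linarith
        have "t * real (Suc m) \<le> real N" unfolding N_def by (rule real_nat_ceiling_ge)
        then have a: "t \<le> real N * (1 / real (Suc m))" by (simp add: field_simps del: of_nat_Suc)
        have "real N < t * real (Suc m) + 1" unfolding N_def using tpos by linarith
        then have b: "real N * (1 / real (Suc m)) < t + 1 / real (Suc m)" by (simp add: field_simps del: of_nat_Suc)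
        have "real N * (1 / real (Suc m)) \<in> A" using \<delta>(2) a b elim by (auto simp del: of_nat_Suc)
        from upper[OF N1 this] have "D m \<le> 1 - q m ^ N" .
        also have "\<dots> \<le> 1 - exp (- s * (\<tau> + e))"
          unfolding q_pow using mult_left_mono[of "real N * (1 / real (Suc m))" "\<tau> + e" s] b elim s
          by (simp del: of_nat_Suc)
        finally show ?case .
      qed
    qed
    have "D \<longlonglongrightarrow> 1 - exp (- s * \<tau>)"
    proof (rule order_tendstoI)
      fix a assume "a < 1 - exp (- s * \<tau>)"
      then show "eventually (\<lambda>m. a < D m) sequentially"
        using lower by (intro always_eventually) (force intro: less_le_trans)
    next
      fix a assume a: "1 - exp (- s * \<tau>) < a"
      have "((\<lambda>e. 1 - exp (- s * (\<tau> + e))) \<longlongrightarrow> 1 - exp (- s * (\<tau> + 0))) (at_right 0)"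
        by (intro tendsto_intros)
      then have "eventually (\<lambda>e. 1 - exp (- s * (\<tau> + e)) < a) (at_right 0)"
        using a by (intro order_tendstoD) auto
      then obtain e where e: "0 < e" "1 - exp (- s * (\<tau> + e)) < a"
        using eventually_happens[OF eventually_conj[OF _ eventually_at_right_less[of "0::real"]]] trivial_limit_at_right_real
        by blast
      show "eventually (\<lambda>m. D m < a) sequentially"
        using ev[OF e(1)] by eventually_elim (use e(2) in linarith)
    qed
    moreover have "exp_decay s T = exp (- s * \<tau>)" using Tfin by (simp add: exp_decay_def \<tau>_def)
    ultimately show ?thesis by (simp add: D_def[abs_def] T_def)
  qed
qed

text \<open>
  For a chain with kernel \<open>A\<close>, the number \<open>1 - (\<Sum>n. (1 - q) q^n survival n x)\<close> is \<open>E\<^sub>x q^N\<close> with \<open>N \<ge> 1\<close> the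
  first step at which the chain is in \<open>y\<close>; at \<open>y\<close> itself it is replaced by the boundary value \<open>1\<close>. The first-step equation is written in
  terms of increments of \<open>f\<close>, so that dividing by the mesh of the grid makes the transition rates
  appear.
\<close>

lemma sampled_transform_system:
  assumes S: "finite S" and A: "\<forall>x\<in>S. (\<forall>z\<in>S. 0 \<le> A x z) \<and> (\<Sum>z\<in>S. A x z) = 1"
    and q: "0 < q" "q < 1" and y: "y \<in> S"
  defines "f \<equiv> \<lambda>x. if x = y then 1 else 1 - (\<Sum>n. (1 - q) * q ^ n * survival A S y n x)"
  shows "x \<in> S \<Longrightarrow> 0 \<le> f x \<and> f x \<le> 1"
    and "x \<in> S - {y} \<Longrightarrow> (1 - q) * f x = q * (\<Sum>z\<in>S - {x}. A x z * (f z - f x))"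
proof -
  define W where "W x = (\<Sum>n. (1 - q) * q ^ n * survival A S y n x)" for x
  have geo: "(\<lambda>n. (1 - q) * q ^ n) sums 1"
    using sums_mult[OF geometric_sums[of q], of "1 - q"] q by simp
  have bds: "0 \<le> survival A S y n x \<and> survival A S y n x \<le> 1" if "x \<in> S" for n x
    by (rule survival_bounds[OF S that A])
  have summ: "summable (\<lambda>n. (1 - q) * q ^ n * survival A S y n x)" if "x \<in> S" for x
    by (rule summable_comparison_test'[OF sums_summable[OF geo], of 0])
       (use q bds[OF that] in \<open>auto simp: abs_mult intro!: mult_left_le\<close>)
  have W: "0 \<le> W x \<and> W x \<le> 1" if "x \<in> S" for x
  proof
    show "0 \<le> W x" unfolding W_def
      by (intro suminf_nonneg summ that) (use q bds[OF that] in auto)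
    have "W x \<le> (\<Sum>n. (1 - q) * q ^ n)" unfolding W_def
      by (intro suminf_le summ that sums_summable[OF geo]) (use q bds[OF that] in \<open>auto intro!: mult_left_le\<close>)
    then show "W x \<le> 1" using geo by (simp add: sums_iff)
  qed
  then show "x \<in> S \<Longrightarrow> 0 \<le> f x \<and> f x \<le> 1" by (auto simp: f_def W_def)
  assume x: "x \<in> S - {y}"
  have "W x = (1 - q) + (\<Sum>n. (1 - q) * q ^ Suc n * survival A S y (Suc n) x)"
    unfolding W_def using suminf_split_head[OF summ[of x]] x by simp
  also have "(\<Sum>n. (1 - q) * q ^ Suc n * survival A S y (Suc n) x) =
      (\<Sum>n. \<Sum>z\<in>S - {y}. q * A x z * ((1 - q) * q ^ n * survival A S y n z))"
    by (intro suminf_cong) (simp add: sum_distrib_left mult_ac)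
  also have "\<dots> = (\<Sum>z\<in>S - {y}. \<Sum>n. q * A x z * ((1 - q) * q ^ n * survival A S y n z))"
    by (intro suminf_sum summable_mult summ) auto
  also have "\<dots> = (\<Sum>z\<in>S - {y}. q * A x z * W z)"
    unfolding W_def by (intro sum.cong refl suminf_mult summ) auto
  finally have W_eq: "W x = (1 - q) + (\<Sum>z\<in>S - {y}. q * A x z * W z)" .
  have row: "(\<Sum>z\<in>S. A x z) = 1" using A x by auto
  have "f x = 1 - W x" using x by (simp add: f_def W_def)
  also have "\<dots> = q * (\<Sum>z\<in>S. A x z) - (\<Sum>z\<in>S - {y}. q * A x z * W z)"
    unfolding W_eq row by simp
  also have "(\<Sum>z\<in>S - {y}. q * A x z * W z) = q * (\<Sum>z\<in>S. A x z * (1 - f z))"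
    unfolding sum.remove[OF S y] by (simp add: f_def W_def sum_distrib_left mult_ac)
  also have "q * (\<Sum>z\<in>S. A x z) - \<dots> = q * (\<Sum>z\<in>S. A x z * f z)"
    by (simp add: right_diff_distrib sum_subtractf)
  finally have fx: "f x = q * (\<Sum>z\<in>S. A x z * f z)" .
  have alg: "(1 - q) * v = q * (m - v)" if "v = q * m" for v m
    using that by (simp add: algebra_simps)
  have "(\<Sum>z\<in>S - {x}. A x z * (f z - f x)) = (\<Sum>z\<in>S. A x z * (f z - f x))"
    using x S by (subst sum.remove[of S x]) auto
  also have "\<dots> = (\<Sum>z\<in>S. A x z * f z) - f x"
    using row by (simp add: right_diff_distrib sum_subtractf flip: sum_distrib_right)
  finally have drift: "(\<Sum>z\<in>S - {x}. A x z * (f z - f x)) = (\<Sum>z\<in>S. A x z * f z) - f x" .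
  show "(1 - q) * f x = q * (\<Sum>z\<in>S - {x}. A x z * (f z - f x))"
    unfolding drift by (rule alg[OF fx])
qed

text \<open>
  A visit to \<open>y\<close> lasts for a positive time, so it can be detected at rational times.
\<close>

lemma first_passage_time_measurable:
  assumes S: "finite S" "y \<in> S" and X: "\<And>t. t \<ge> 0 \<Longrightarrow> X t \<in> P \<rightarrow>\<^sub>M count_space S"
    and hold: "\<And>w t. w \<in> space P \<Longrightarrow> t \<ge> 0 \<Longrightarrow> \<forall>\<^sub>F s in at_right t. X s w = X t w"
  shows "first_passage_time X y \<in> borel_measurable P"
proof (rule borel_measurableI_less)
  fix a :: ennreal
  have "{w \<in> space P. first_passage_time X y w < a} =
      (\<Union>r\<in>{r\<in>\<rat>. 0 < r \<and> ennreal r < a}. {w \<in> space P. X r w = y})"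
  proof (intro equalityI subsetI)
    fix w assume w: "w \<in> {w \<in> space P. first_passage_time X y w < a}"
    then obtain t where t: "0 < t" "X t w = y" "ennreal t < a"
      by (auto simp: first_passage_time_def INF_less_iff)
    have "((\<lambda>s. ennreal s) \<longlongrightarrow> ennreal t) (at_right t)" by (intro tendsto_intros)
    then have "eventually (\<lambda>s. ennreal s < a) (at_right t)"
      using t(3) by (rule order_tendstoD)
    then have "eventually (\<lambda>s. ennreal s < a \<and> X s w = y \<and> t < s) (at_right t)"
      using hold[of w t] w t by (auto intro!: eventually_conj eventually_at_right_less)
    then obtain b where b: "t < b" "\<And>s. t < s \<Longrightarrow> s < b \<Longrightarrow> ennreal s < a \<and> X s w = y"
      unfolding eventually_at_right_field by auto
    then obtain r where "r \<in> \<rat>" "t < r" "r < b" using Rats_dense_in_real by blast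
    then show "w \<in> (\<Union>r\<in>{r\<in>\<rat>. 0 < r \<and> ennreal r < a}. {w \<in> space P. X r w = y})"
      using b t w by (intro UN_I[of r]) auto
  next
    fix w assume "w \<in> (\<Union>r\<in>{r\<in>\<rat>. 0 < r \<and> ennreal r < a}. {w \<in> space P. X r w = y})"
    then show "w \<in> {w \<in> space P. first_passage_time X y w < a}"
      by (auto simp: first_passage_time_def INF_less_iff)
  qed
  moreover have "{w \<in> space P. X r w = y} \<in> sets P" if "0 < r" for r
  proof -
    have "X r -` {y} \<inter> space P \<in> sets P"
      using that S by (intro measurable_sets[OF X]) auto
    moreover have "X r -` {y} \<inter> space P = {w \<in> space P. X r w = y}" by auto
    ultimately show ?thesis by (simp only:)
  qed
  moreover have "countable {r\<in>\<rat>. 0 < r \<and> ennreal r < a}"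
    by (rule countable_subset[OF _ countable_rat]) auto
  ultimately show "{w \<in> space P. first_passage_time X y w < a} \<in> sets P"
    by (auto intro!: sets.countable_UN')
qed

text \<open>
  The transforms of the sampled chains are bounded, so along some sequence of grids they converge for
  all starting points at once, and the limit satisfies the differential form of the first-step
  equations. Only at \<open>x\<^sub>0\<close> does the limit have to be identified; there the sampled passage times
  converge pathwise.
\<close>

lemma first_passage_transform:
  assumes mp: "markov_process P S q x\<^sub>0 X" and x0: "x\<^sub>0 \<in> S" "x\<^sub>0 \<noteq> y" and y: "y \<in> S" and s: "0 < s"
  obtains f where "\<And>x. x \<in> S \<Longrightarrow> 0 \<le> f x \<and> f x \<le> 1" "f y = 1"
    "\<And>x. x \<in> S - {y} \<Longrightarrow> s * f x = (\<Sum>z\<in>S - {x}. q x z * (f z - f x))"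
    "f x\<^sub>0 = (\<integral>w. exp_decay s (first_passage_time X y w) \<partial>P)"
proof -
  have P: "prob_space P" and S: "finite S" and X: "\<And>t. t \<ge> 0 \<Longrightarrow> X t \<in> P \<rightarrow>\<^sub>M count_space S"
    and hold: "\<And>w t. w \<in> space P \<Longrightarrow> t \<ge> 0 \<Longrightarrow> \<forall>\<^sub>F s in at_right t. X s w = X t w"
    and start: "AE w in P. X 0 w = x\<^sub>0"
    using mp by (auto simp: markov_process_def)
  obtain p where tf: "transition_function S p" and rates: "has_transition_rates S p q"
    and mprop: "markov_property P S p X"
    using mp by (auto simp: markov_process_def)
  interpret prob_space P by fact
  define h where "h m = 1 / real (Suc m)" for m
  have h: "0 < h m" for m by (simp add: h_def)
  define c where "c m = exp (- s * h m)" for m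
  have c: "0 < c m" "c m < 1" for m using s h[of m] by (auto simp: c_def)
  define F where "F m x = (if x = y then 1 else 1 - (\<Sum>n. (1 - c m) * c m ^ n * survival (p (h m)) S y n x))" for m x
  have kernel: "\<forall>x\<in>S. (\<forall>z\<in>S. 0 \<le> p (h m) x z) \<and> (\<Sum>z\<in>S. p (h m) x z) = 1" for m
    using tf h[of m] unfolding transition_function_def by (meson less_imp_le)
  have F_bounds: "0 \<le> F m x \<and> F m x \<le> 1" if "x \<in> S" for m x
    unfolding F_def by (rule sampled_transform_system(1)[OF S kernel c y that])
  have F_eq: "(1 - c m) * F m x = c m * (\<Sum>z\<in>S - {x}. p (h m) x z * (F m z - F m x))" if "x \<in> S - {y}" for m x
    unfolding F_def by (rule sampled_transform_system(2)[OF S kernel c y that])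
  obtain r g where r: "strict_mono r" and g: "\<And>x. x \<in> S \<Longrightarrow> (\<lambda>n. F (r n) x) \<longlonglongrightarrow> g x"
    by (rule finite_family_convergent_subsequence[OF S, of F 1]) (use F_bounds in auto)
  have h0: "h \<longlonglongrightarrow> 0" using LIMSEQ_inverse_real_of_nat by (simp add: h_def[abs_def] inverse_eq_divide)
  have hr: "filterlim (\<lambda>n. h (r n)) (at_right 0) sequentially"
    unfolding filterlim_at using LIMSEQ_subseq_LIMSEQ[OF h0 r] h h[THEN less_imp_neq, THEN not_sym]
    by (auto simp: o_def)
  have "((\<lambda>u. 1 - exp (- s * u)) has_field_derivative s) (at 0)"
    by (auto intro!: derivative_eq_intros)
  then have "((\<lambda>u. (1 - exp (- s * u)) / u) \<longlongrightarrow> s) (at_right 0)"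
    unfolding has_field_derivative_iff by (auto intro: tendsto_mono[OF at_le])
  from filterlim_compose[OF this hr] have lim_c: "(\<lambda>n. (1 - c (r n)) / h (r n)) \<longlonglongrightarrow> s"
    by (simp add: c_def)
  have "((\<lambda>u. exp (- s * u)) \<longlongrightarrow> exp (- s * 0)) (at_right 0)" by (intro tendsto_intros)
  from filterlim_compose[OF this hr] have lim_c1: "(\<lambda>n. c (r n)) \<longlonglongrightarrow> 1"
    by (simp add: c_def)
  have lim_p: "(\<lambda>n. p (h (r n)) x z / h (r n)) \<longlonglongrightarrow> q x z" if "x \<in> S" "z \<in> S - {x}" for x z
  proof -
    have "((\<lambda>u. p u x z / u) \<longlongrightarrow> q x z) (at_right 0)"
      using rates that unfolding has_transition_rates_def by auto
    from filterlim_compose[OF this hr] show ?thesis .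
  qed
  show ?thesis
  proof (rule that)
    show "0 \<le> g x \<and> g x \<le> 1" if "x \<in> S" for x
      using LIMSEQ_le_const[OF g[OF that], of 0] LIMSEQ_le_const2[OF g[OF that], of 1] F_bounds[OF that] by auto
    have "(\<lambda>n. F (r n) y) \<longlonglongrightarrow> 1" by (simp add: F_def)
    then show "g y = 1" using g[OF y] by (rule LIMSEQ_unique[rotated])
    show "s * g x = (\<Sum>z\<in>S - {x}. q x z * (g z - g x))" if x: "x \<in> S - {y}" for x
    proof -
      have 1: "(\<lambda>n. (1 - c (r n)) / h (r n) * F (r n) x) \<longlonglongrightarrow> s * g x"
        using x by (intro tendsto_mult lim_c g) auto
      have 2: "(\<lambda>n. c (r n) * (\<Sum>z\<in>S - {x}. p (h (r n)) x z / h (r n) * (F (r n) z - F (r n) x)))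
          \<longlonglongrightarrow> 1 * (\<Sum>z\<in>S - {x}. q x z * (g z - g x))"
        using x by (intro tendsto_mult tendsto_sum tendsto_diff lim_c1 lim_p g) auto
      have "(1 - c (r n)) / h (r n) * F (r n) x =
          c (r n) * (\<Sum>z\<in>S - {x}. p (h (r n)) x z / h (r n) * (F (r n) z - F (r n) x))" for n
      proof -
        have "(1 - c (r n)) / h (r n) * F (r n) x = (1 - c (r n)) * F (r n) x / h (r n)" by simp
        also have "\<dots> = c (r n) * (\<Sum>z\<in>S - {x}. p (h (r n)) x z * (F (r n) z - F (r n) x)) / h (r n)"
          by (simp only: F_eq[OF x])
        also have "\<dots> = c (r n) * ((\<Sum>z\<in>S - {x}. p (h (r n)) x z * (F (r n) z - F (r n) x)) / h (r n))"
          by simp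
        also have "(\<Sum>z\<in>S - {x}. p (h (r n)) x z * (F (r n) z - F (r n) x)) / h (r n) =
            (\<Sum>z\<in>S - {x}. p (h (r n)) x z / h (r n) * (F (r n) z - F (r n) x))"
          by (simp add: sum_divide_distrib)
        finally show ?thesis .
      qed
      then show ?thesis using LIMSEQ_unique[OF 1] 2 by simp
    qed
    define T where "T = first_passage_time X y"
    have T[measurable]: "T \<in> borel_measurable P"
      unfolding T_def by (rule first_passage_time_measurable[OF S y X hold])
    \<comment> \<open>The sum \<open>D m\<close> below equals \<open>1 - exp(-s T)\<close> with \<open>T\<close> replaced by the first visit on the grid
        of mesh \<open>h m\<close>.\<close>
    define I where "I m n w = (if \<forall>i\<in>{1..n}. X (real i * h m) w \<noteq> y then 1 else 0 :: real)" for m n w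
    have evI: "{w \<in> space P. \<forall>i\<in>{1..n}. X (real i * h m) w \<noteq> y} \<in> events" for m n
    proof (intro sets.sets_Collect_finite_All)
      fix i assume i: "i \<in> {1..n}"
      have "X (real i * h m) -` (S - {y}) \<inter> space P \<in> events"
        using h[of m] by (intro measurable_sets[OF X]) auto
      also have "X (real i * h m) -` (S - {y}) \<inter> space P = {w \<in> space P. X (real i * h m) w \<noteq> y}"
        using measurable_space[OF X, of "real i * h m"] h[of m] by auto
      finally show "{w \<in> space P. X (real i * h m) w \<noteq> y} \<in> events" .
    qed simp
    have I_meas[measurable]: "I m n \<in> borel_measurable P" for m n
      unfolding I_def[abs_def] by (intro measurable_If evI) auto
    have I_bound: "0 \<le> I m n w \<and> I m n w \<le> 1" for m n w by (simp add: I_def)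
    have I_int: "integrable P (I m n)" for m n
      by (rule integrable_const_bound[of _ 1]) (use I_bound in auto)
    have I_exp: "(\<integral>w. I m n w \<partial>P) = survival (p (h m)) S y n x\<^sub>0" for m n
    proof -
      have "(\<integral>w. I m n w \<partial>P) = (\<integral>w. indicator {w \<in> space P. \<forall>i\<in>{1..n}. X (real i * h m) w \<noteq> y} w \<partial>P)"
        by (intro Bochner_Integration.integral_cong) (auto simp: I_def indicator_def)
      also have "\<dots> = \<P>(w in P. \<forall>i\<in>{1..n}. X (real i * h m) w \<noteq> y)"
        using evI by simp
      also have "\<dots> = survival (p (h m)) S y n x\<^sub>0"
        by (rule markov_survival[OF P S X mprop start x0 h])
      finally show ?thesis .
    qed
    define D where "D m w = (\<Sum>n. (1 - c m) * c m ^ n * I m n w)" for m w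
    have geo: "(\<lambda>n. (1 - c m) * c m ^ n) sums 1" for m
      using sums_mult[OF geometric_sums[of "c m"], of "1 - c m"] c[of m] by simp
    have summ: "summable (\<lambda>n. (1 - c m) * c m ^ n * I m n w)" for m w
      by (rule summable_comparison_test'[OF sums_summable[OF geo[of m]], of 0])
         (use c[of m] I_bound in \<open>auto simp: abs_mult intro!: mult_left_le\<close>)
    have D_bound: "norm (D m w) \<le> 1" for m w
    proof -
      have "0 \<le> D m w" unfolding D_def
        by (intro suminf_nonneg summ) (use c[of m] I_bound in auto)
      moreover have "D m w \<le> (\<Sum>n. (1 - c m) * c m ^ n)" unfolding D_def
        by (intro suminf_le summ sums_summable[OF geo]) (use c[of m] I_bound in \<open>auto intro!: mult_left_le\<close>)
      ultimately show ?thesis using geo[of m] by (simp add: sums_iff)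
    qed
    have D_exp: "(\<integral>w. D m w \<partial>P) = 1 - F m x\<^sub>0" for m
    proof -
      have "(\<integral>w. D m w \<partial>P) = (\<Sum>n. \<integral>w. (1 - c m) * c m ^ n * I m n w \<partial>P)"
        unfolding D_def
      proof (rule integral_suminf)
        show "integrable P (\<lambda>w. (1 - c m) * c m ^ n * I m n w)" for n
          by (intro integrable_mult_right I_int)
        show "AE w in P. summable (\<lambda>n. norm ((1 - c m) * c m ^ n * I m n w))"
          using summ[of m] c[of m] I_bound by (intro AE_I2) (simp add: abs_mult)
        have "(\<integral>w. norm ((1 - c m) * c m ^ n * I m n w) \<partial>P) = (1 - c m) * c m ^ n * (\<integral>w. I m n w \<partial>P)" for n
          using c[of m] I_bound by (simp add: abs_mult)
        moreover have "summable (\<lambda>n. (1 - c m) * c m ^ n * (\<integral>w. I m n w \<partial>P))"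
          unfolding I_exp
          by (rule summable_comparison_test'[OF sums_summable[OF geo[of m]], of 0])
             (use c[of m] survival_bounds[OF S x0(1) kernel] in \<open>auto simp: abs_mult intro!: mult_left_le\<close>)
        ultimately show "summable (\<lambda>n. \<integral>w. norm ((1 - c m) * c m ^ n * I m n w) \<partial>P)"
          by presburger
      qed
      then show ?thesis using x0 by (simp add: I_exp F_def)
    qed
    have D_lim: "(\<lambda>m. D m w) \<longlonglongrightarrow> 1 - exp_decay s (T w)" if w: "w \<in> space P" for w
    proof -
      define A where "A = {t. 0 < t \<and> X t w = y}"
      have "\<exists>\<delta>>0. {t..<t+\<delta>} \<subseteq> A" if "t \<in> A" for t
      proof -
        have "\<forall>\<^sub>F u in at_right t. X u w = y"
          using hold[OF w, of t] that by (auto simp: A_def)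
        then obtain b where b: "t < b" "\<And>u. t < u \<Longrightarrow> u < b \<Longrightarrow> X u w = y"
          unfolding eventually_at_right_field by auto
        show ?thesis
        proof (intro exI[of _ "b - t"] conjI subsetI)
          fix u assume "u \<in> {t..<t + (b - t)}"
          then show "u \<in> A" using b that by (cases "u = t") (auto simp: A_def)
        qed (use b in simp)
      qed
      from sampled_decay_tendsto[of A s, OF _ this s]
      have "(\<lambda>m. \<Sum>n. (1 - c m) * c m ^ n * (if \<forall>i\<in>{1..n}. real i * h m \<notin> A then 1 else 0))
          \<longlonglongrightarrow> 1 - exp_decay s (INF t\<in>A. ennreal t)"
        by (simp add: c_def h_def A_def)
      moreover have "(\<forall>i\<in>{1..n}. real i * h m \<notin> A) \<longleftrightarrow> (\<forall>i\<in>{1..n}. X (real i * h m) w \<noteq> y)" for n m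
        using h[of m] by (auto simp: A_def)
      moreover have "(INF t\<in>A. ennreal t) = T w"
        by (simp add: A_def T_def first_passage_time_def)
      ultimately show ?thesis by (simp add: D_def I_def)
    qed
    have "(\<lambda>m. \<integral>w. D m w \<partial>P) \<longlonglongrightarrow> (\<integral>w. 1 - exp_decay s (T w) \<partial>P)"
    proof (rule integral_dominated_convergence[where w = "\<lambda>_. 1"])
      show "D m \<in> borel_measurable P" for m unfolding D_def[abs_def] by measurable
    qed (use D_lim D_bound in auto)
    moreover have "integrable P (\<lambda>w. exp_decay s (T w))"
      by (rule integrable_const_bound[of _ 1]) (use exp_decay_bounds[of s] s in auto)
    ultimately have "(\<lambda>m. 1 - F m x\<^sub>0) \<longlonglongrightarrow> 1 - (\<integral>w. exp_decay s (T w) \<partial>P)"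
      by (simp add: D_exp prob_space)
    from tendsto_diff[OF tendsto_const[of 1] this]
    have "(\<lambda>m. F m x\<^sub>0) \<longlonglongrightarrow> (\<integral>w. exp_decay s (T w) \<partial>P)" by simp
    from LIMSEQ_unique[OF LIMSEQ_subseq_LIMSEQ[OF this r], of "g x\<^sub>0"] g[OF x0(1)]
    show "g x\<^sub>0 = (\<integral>w. exp_decay s (first_passage_time X y w) \<partial>P)"
      by (simp add: o_def T_def)
  qed
qed

text \<open>
  As \<open>s\<close> decreases to \<open>0\<close>, \<open>(1 - exp(-s t)) / s\<close> approaches \<open>t\<close> from below, also for \<open>t = \<infinity>\<close>. Finiteness of
  the mean is thus a conclusion: it follows from convergence of the difference quotients.
\<close>

lemma nn_integral_from_transform:
  assumes P: "prob_space P" and T[measurable]: "T \<in> borel_measurable P"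
    and lim: "(\<lambda>n. real (Suc n) * (1 - (\<integral>w. exp_decay (1 / real (Suc n)) (T w) \<partial>P))) \<longlonglongrightarrow> m"
  shows "(\<integral>\<^sup>+ w. T w \<partial>P) = ennreal m"
proof -
  interpret prob_space P by fact
  define G where "G n w = real (Suc n) * (1 - exp_decay (1 / real (Suc n)) (T w))" for n w
  have G_bound: "0 \<le> G n w \<and> G n w \<le> real (Suc n)" for n w
    using exp_decay_bounds[of "1 / real (Suc n)" "T w"] unfolding G_def
    by (auto intro!: mult_left_le simp del: of_nat_Suc)
  have G_meas[measurable]: "G n \<in> borel_measurable P" for n unfolding G_def[abs_def] by measurable
  have dec_int: "integrable P (\<lambda>w. exp_decay (1 / real (Suc n)) (T w))" for n
    by (rule integrable_const_bound[of _ 1]) (use exp_decay_bounds[of "1 / real (Suc n)"] in auto)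
  have G_int: "integrable P (G n)" for n
    unfolding G_def[abs_def] by (intro integrable_mult_right Bochner_Integration.integrable_diff dec_int) simp
  have "(\<integral>w. G n w \<partial>P) = real (Suc n) * (1 - (\<integral>w. exp_decay (1 / real (Suc n)) (T w) \<partial>P))" for n
    unfolding G_def by (simp add: dec_int prob_space del: of_nat_Suc)
  then have nnG: "(\<integral>\<^sup>+ w. ennreal (G n w) \<partial>P) =
      ennreal (real (Suc n) * (1 - (\<integral>w. exp_decay (1 / real (Suc n)) (T w) \<partial>P)))" for n
    using G_int G_bound by (subst nn_integral_eq_integral) auto
  have lim': "(\<lambda>n. \<integral>\<^sup>+ w. ennreal (G n w) \<partial>P) \<longlonglongrightarrow> ennreal m"
    unfolding nnG using lim by (intro tendsto_intros)
  have G_le: "ennreal (G n w) \<le> T w" for n w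
  proof (cases "T w = \<infinity>")
    case False
    then have T: "T w = ennreal (enn2real (T w))" by (simp add: less_top)
    have "1 - enn2real (T w) / real (Suc n) \<le> exp (- (enn2real (T w) / real (Suc n)))"
      using exp_ge_add_one_self[of "- (enn2real (T w) / real (Suc n))"] by simp
    then have "real (Suc n) * (1 - exp (- (enn2real (T w) / real (Suc n)))) \<le> enn2real (T w)"
      by (simp add: field_simps del: of_nat_Suc)
    then have "G n w \<le> enn2real (T w)" using False by (simp add: G_def exp_decay_def del: of_nat_Suc)
    then show ?thesis by (subst T) (rule ennreal_leI)
  qed auto
  have G_lim: "(\<lambda>n. ennreal (G n w)) \<longlonglongrightarrow> T w" for w
  proof (cases "T w = \<infinity>")
    case True
    then have "G n w = real (Suc n)" for n by (simp add: G_def exp_decay_def)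
    moreover have "(\<lambda>n. ennreal (real (Suc n))) \<longlonglongrightarrow> \<infinity>"
      using LIMSEQ_Suc[OF of_nat_tendsto_top_ennreal] by (simp only: ennreal_of_nat_eq_real_of_nat infinity_ennreal_def)
    ultimately show ?thesis using True by simp
  next
    case False
    define \<tau> where "\<tau> = enn2real (T w)"
    have T: "T w = ennreal \<tau>" using False by (simp add: \<tau>_def less_top)
    have "((\<lambda>u. 1 - exp (- \<tau> * u)) has_field_derivative \<tau>) (at 0)"
      by (auto intro!: derivative_eq_intros)
    then have "((\<lambda>u. (1 - exp (- \<tau> * u)) / u) \<longlongrightarrow> \<tau>) (at 0)"
      unfolding has_field_derivative_iff by simp
    moreover have "filterlim (\<lambda>n. 1 / real (Suc n)) (at 0) sequentially"
      using LIMSEQ_inverse_real_of_nat by (auto simp: filterlim_at inverse_eq_divide)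
    ultimately have "(\<lambda>n. (1 - exp (- \<tau> * (1 / real (Suc n)))) / (1 / real (Suc n))) \<longlonglongrightarrow> \<tau>"
      by (rule filterlim_compose)
    moreover have "(1 - exp (- \<tau> * (1 / real (Suc n)))) / (1 / real (Suc n)) = G n w" for n
      using False by (simp add: G_def exp_decay_def \<tau>_def mult.commute)
    ultimately show ?thesis unfolding T by (intro tendsto_intros) simp
  qed
  have "(\<integral>\<^sup>+ w. T w \<partial>P) = (\<integral>\<^sup>+ w. liminf (\<lambda>n. ennreal (G n w)) \<partial>P)"
    using lim_imp_Liminf[OF sequentially_bot G_lim] by simp
  also have "\<dots> \<le> liminf (\<lambda>n. \<integral>\<^sup>+ w. ennreal (G n w) \<partial>P)"
    by (intro nn_integral_liminf) measurable
  also have "\<dots> = ennreal m" by (rule lim_imp_Liminf[OF sequentially_bot lim'])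
  finally have "(\<integral>\<^sup>+ w. T w \<partial>P) \<le> ennreal m" .
  moreover have "ennreal m \<le> (\<integral>\<^sup>+ w. T w \<partial>P)"
    by (rule LIMSEQ_le_const2[OF lim']) (auto intro!: nn_integral_mono G_le)
  ultimately show ?thesis by simp
qed

section \<open>Passage across the star in terms of reversible weights\<close>

text \<open>
  The reversible measure of a branch of size \<open>n\<close>, normalised to \<open>1\<close> at the idle state: up-rates \<open>(n - i) \<nu>\<close>
  and down-rates \<open>i\<close> are in detailed balance with it.
\<close>

definition weight :: "nat \<Rightarrow> real \<Rightarrow> nat \<Rightarrow> real" where
  "weight n \<nu> j = real (n choose j) * \<nu> ^ j"

text \<open>
  For \<open>g = 1\<close> this is the classical formula for the mean time a birth-and-death chain needs to descend
  from \<open>l\<close> to \<open>0\<close>. Keeping \<open>g\<close> general serves the Laplace transforms, where \<open>g\<close> is the transform itself.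
\<close>

definition descent :: "nat \<Rightarrow> real \<Rightarrow> (nat \<Rightarrow> real) \<Rightarrow> nat \<Rightarrow> real" where
  "descent n \<nu> g l = (\<Sum>i=1..l. (\<Sum>j=i..n. weight n \<nu> j * g j) / (real i * weight n \<nu> i))"

text \<open>
  The counterpart for climbing from \<open>0\<close> to \<open>l\<close>, where \<open>r\<close> is the contribution of all states outside the
  branch.
\<close>

definition ascent :: "nat \<Rightarrow> real \<Rightarrow> real \<Rightarrow> (nat \<Rightarrow> real) \<Rightarrow> nat \<Rightarrow> real" where
  "ascent n \<nu> r g l = (\<Sum>i=1..l. (r + (\<Sum>j=1..<i. weight n \<nu> j * g j)) / (real i * weight n \<nu> i))"

lemma weight_pos: "0 < \<nu> \<Longrightarrow> j \<le> n \<Longrightarrow> 0 < weight n \<nu> j"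
  by (simp add: weight_def)

lemma weight_balance:
  assumes "i \<le> n"
  shows "real (Suc i) * weight n \<nu> (Suc i) = (real n - real i) * \<nu> * weight n \<nu> i"
proof -
  have "Suc i * (n choose Suc i) = (n - i) * (n choose i)"
    using binomial_absorption[of i n] binomial_absorb_comp[of n i] by simp
  then have "real (Suc i) * real (n choose Suc i) = (real n - real i) * real (n choose i)"
    using assms by (metis of_nat_diff of_nat_mult)
  from arg_cong[OF this, of "\<lambda>u. u * \<nu> ^ Suc i"] show ?thesis
    by (simp add: weight_def mult_ac del: of_nat_Suc)
qed

text \<open>
  Multiplying the recursion by the reversible weight turns it into a balance of fluxes. No flux crosses
  the top of the branch, hence the flux through edge \<open>i\<close> is what is absorbed above it.
\<close>

lemma branch_descent_flux:
  assumes eq: "\<And>l. 1 \<le> l \<Longrightarrow> l \<le> n \<Longrightarrow>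
      s * g l = (real n - real l) * \<nu> * (g (Suc l) - g l) + real l * (g (l - 1) - g l)"
    and i: "1 \<le> i" "i \<le> n"
  shows "real i * weight n \<nu> i * (g (i - 1) - g i) = s * (\<Sum>j=i..n. weight n \<nu> j * g j)"
  using i(2)
proof (induction rule: inc_induct)
  case base
  have "real n * weight n \<nu> n * (g (n - 1) - g n) = weight n \<nu> n * (real n * (g (n - 1) - g n))"
    by simp
  also have "real n * (g (n - 1) - g n) = s * g n" using eq[of n] i by simp
  finally show ?case by simp
next
  case (step l)
  have "real l * weight n \<nu> l * (g (l - 1) - g l) =
      weight n \<nu> l * (real l * (g (l - 1) - g l))"
    by simp
  also have "real l * (g (l - 1) - g l) = s * g l + (real n - real l) * \<nu> * (g l - g (Suc l))"
    using eq[of l] step i by (simp add: algebra_simps)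
  also have "weight n \<nu> l * (s * g l + (real n - real l) * \<nu> * (g l - g (Suc l))) =
      weight n \<nu> l * (s * g l) + (real n - real l) * \<nu> * weight n \<nu> l * (g l - g (Suc l))"
    by (simp add: algebra_simps)
  also have "(real n - real l) * \<nu> * weight n \<nu> l = real (Suc l) * weight n \<nu> (Suc l)"
    using step by (intro weight_balance[symmetric]) simp
  also have "real (Suc l) * weight n \<nu> (Suc l) * (g l - g (Suc l)) = s * (\<Sum>j=Suc l..n. weight n \<nu> j * g j)"
    using step.IH by simp
  also have "weight n \<nu> l * (s * g l) + s * (\<Sum>j=Suc l..n. weight n \<nu> j * g j) = s * (\<Sum>j=l..n. weight n \<nu> j * g j)"
    using step by (simp add: sum.atLeast_Suc_atMost[of l n] algebra_simps)
  finally show ?case .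
qed

lemma branch_descent:
  assumes "0 < \<nu>" and eq: "\<And>l. 1 \<le> l \<Longrightarrow> l \<le> n \<Longrightarrow>
      s * g l = (real n - real l) * \<nu> * (g (Suc l) - g l) + real l * (g (l - 1) - g l)"
    and "l \<le> n"
  shows "g 0 - g l = s * descent n \<nu> g l"
  using assms(3)
proof (induction l)
  case (Suc l)
  have "g l - g (Suc l) = s * (\<Sum>j=Suc l..n. weight n \<nu> j * g j) / (real (Suc l) * weight n \<nu> (Suc l))"
    using branch_descent_flux[of n s g \<nu> "Suc l", OF eq] Suc.prems weight_pos[OF assms(1) Suc.prems]
    by (simp add: field_simps del: of_nat_Suc)
  then show ?case using Suc by (simp add: descent_def algebra_simps del: of_nat_Suc)
qed (simp add: descent_def)

text \<open>
  The same balance counted from below: the flux through edge \<open>i\<close> is the inflow from the idle state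
  plus what is absorbed below the edge. The recursion fails at the target, so only edges up to the
  target are covered.
\<close>

lemma branch_ascent_flux:
  assumes eq: "\<And>i. 1 \<le> i \<Longrightarrow> i < l \<Longrightarrow>
      s * g i = (real n - real i) * \<nu> * (g (Suc i) - g i) + real i * (g (i - 1) - g i)"
    and inflow: "real n * \<nu> * (g 1 - g 0) = s * r"
    and i: "1 \<le> i" "i \<le> l" "l \<le> n"
  shows "real i * weight n \<nu> i * (g i - g (i - 1)) = s * (r + (\<Sum>j=1..<i. weight n \<nu> j * g j))"
  using i(1,2)
proof (induction i rule: dec_induct)
  case base
  then show ?case using inflow by (simp add: weight_def)
next
  case (step i)
  have "real (Suc i) * weight n \<nu> (Suc i) * (g (Suc i) - g (Suc i - 1)) =
      weight n \<nu> i * ((real n - real i) * \<nu> * (g (Suc i) - g i))"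
    using step i by (subst weight_balance) auto
  also have "(real n - real i) * \<nu> * (g (Suc i) - g i) = s * g i + real i * (g i - g (i - 1))"
    using eq[of i] step by (simp add: algebra_simps)
  also have "weight n \<nu> i * (s * g i + real i * (g i - g (i - 1))) =
      s * weight n \<nu> i * g i + real i * weight n \<nu> i * (g i - g (i - 1))"
    by (simp add: algebra_simps)
  also have "\<dots> = s * weight n \<nu> i * g i + s * (r + (\<Sum>j=1..<i. weight n \<nu> j * g j))"
    using step by simp
  also have "\<dots> = s * (r + (\<Sum>j=1..<Suc i. weight n \<nu> j * g j))"
    using step by (simp add: algebra_simps)
  finally show ?case .
qed

lemma branch_ascent:
  assumes "0 < \<nu>" and eq: "\<And>i. 1 \<le> i \<Longrightarrow> i < m \<Longrightarrow>
      s * g i = (real n - real i) * \<nu> * (g (Suc i) - g i) + real i * (g (i - 1) - g i)"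
    and inflow: "real n * \<nu> * (g 1 - g 0) = s * r"
    and m: "m \<le> n" and l: "l \<le> m"
  shows "g l - g 0 = s * ascent n \<nu> r g l"
  using l
proof (induction l)
  case (Suc l)
  have "g (Suc l) - g l = s * (r + (\<Sum>j=1..<Suc l. weight n \<nu> j * g j)) / (real (Suc l) * weight n \<nu> (Suc l))"
    using branch_ascent_flux[of m s g n \<nu> r "Suc l", OF eq inflow] Suc.prems m weight_pos[OF assms(1), of "Suc l" n]
    by (simp add: field_simps del: of_nat_Suc sum.op_ivl_Suc)
  then show ?case using Suc by (simp add: ascent_def algebra_simps del: of_nat_Suc sum.op_ivl_Suc)
qed (simp add: ascent_def)

lemma descent_mono:
  assumes "0 < \<nu>" "l \<le> n" "\<And>j. 1 \<le> j \<Longrightarrow> j \<le> n \<Longrightarrow> g j \<le> g' j"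
  shows "descent n \<nu> g l \<le> descent n \<nu> g' l"
  unfolding descent_def
proof (intro sum_mono divide_right_mono mult_left_mono)
  fix i j assume "i \<in> {1..l}" "j \<in> {i..n}"
  then show "g j \<le> g' j" "0 \<le> weight n \<nu> j"
    using assms weight_pos[of \<nu> j n] by auto
next
  fix i assume "i \<in> {1..l}"
  then show "0 \<le> real i * weight n \<nu> i" using assms weight_pos[of \<nu> i n] by auto
qed

lemma ascent_mono:
  assumes "0 < \<nu>" "l \<le> n" "r \<le> r'" "\<And>j. 1 \<le> j \<Longrightarrow> j < l \<Longrightarrow> g j \<le> g' j"
  shows "ascent n \<nu> r g l \<le> ascent n \<nu> r' g' l"
  unfolding ascent_def
proof (intro sum_mono divide_right_mono add_mono mult_left_mono)
  fix i j assume "i \<in> {1..l}" "j \<in> {1..<i}"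
  then show "g j \<le> g' j" "0 \<le> weight n \<nu> j"
    using assms weight_pos[of \<nu> j n] by auto
next
  fix i assume "i \<in> {1..l}"
  then show "0 \<le> real i * weight n \<nu> i" using assms weight_pos[of \<nu> i n] by auto
qed (use assms in auto)

text \<open>
  The idle state serves as the common bottom of all branches.
\<close>

fun along :: "(state \<Rightarrow> real) \<Rightarrow> nat \<Rightarrow> nat \<Rightarrow> real" where
  "along f k 0 = f Idle"
| "along f k (Suc l) = f (Active k (Suc l))"

lemma along_pos: "0 < l \<Longrightarrow> along f k l = f (Active k l)"
  by (cases l) auto

lemma finite_Omega: "finite (Omega K L)"
proof -
  have "Omega K L = insert Idle ((\<lambda>(k, l). Active k l) ` (SIGMA k:{1..K}. {1..L k}))"
    by (auto simp: Omega_def image_def)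
  then show ?thesis by simp
qed

lemma generator_Active:
  assumes k: "k \<in> {1..K}" and l: "1 \<le> l" "l \<le> L k"
  shows "(\<Sum>z\<in>Omega K L - {Active k l}. rate L \<nu> (Active k l) z * (f z - f (Active k l))) =
    (real (L k) - real l) * \<nu> * (along f k (Suc l) - along f k l) + real l * (along f k (l - 1) - along f k l)"
proof -
  define down where "down = (if l = 1 then Idle else Active k (l - 1))"
  define up where "up = (if l = L k then {} else {Active k (Suc l)})"
  have "(\<Sum>z\<in>Omega K L - {Active k l}. rate L \<nu> (Active k l) z * (f z - f (Active k l))) =
      (\<Sum>z\<in>insert down up. rate L \<nu> (Active k l) z * (f z - f (Active k l)))"
  proof (rule sum.mono_neutral_right)
    show "insert down up \<subseteq> Omega K L - {Active k l}"
      using assms by (auto simp: down_def up_def Omega_def)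
    show "\<forall>z\<in>Omega K L - {Active k l} - insert down up. rate L \<nu> (Active k l) z * (f z - f (Active k l)) = 0"
    proof
      fix z assume z: "z \<in> Omega K L - {Active k l} - insert down up"
      show "rate L \<nu> (Active k l) z * (f z - f (Active k l)) = 0"
        using z assms by (cases z) (auto simp: down_def up_def Omega_def split: if_splits)
    qed
  qed (use finite_Omega in auto)
  also have "\<dots> = rate L \<nu> (Active k l) down * (f down - f (Active k l)) +
      (\<Sum>z\<in>up. rate L \<nu> (Active k l) z * (f z - f (Active k l)))"
    by (rule sum.insert) (auto simp: up_def down_def)
  also have "rate L \<nu> (Active k l) down * (f down - f (Active k l)) = real l * (along f k (l - 1) - along f k l)"
    using l by (auto simp: down_def along_pos)
  also have "(\<Sum>z\<in>up. rate L \<nu> (Active k l) z * (f z - f (Active k l))) =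
      (real (L k) - real l) * \<nu> * (along f k (Suc l) - along f k l)"
    using l by (auto simp: up_def along_pos)
  finally show ?thesis by simp
qed

lemma generator_Idle:
  assumes "\<forall>k\<in>{1..K}. L k \<ge> 1"
  shows "(\<Sum>z\<in>Omega K L - {Idle}. rate L \<nu> Idle z * (f z - f Idle)) =
    (\<Sum>k\<in>{1..K}. real (L k) * \<nu> * (along f k 1 - along f k 0))"
proof -
  have "(\<Sum>z\<in>Omega K L - {Idle}. rate L \<nu> Idle z * (f z - f Idle)) =
      (\<Sum>z\<in>(\<lambda>k. Active k 1) ` {1..K}. rate L \<nu> Idle z * (f z - f Idle))"
  proof (rule sum.mono_neutral_right)
    show "(\<lambda>k. Active k 1) ` {1..K} \<subseteq> Omega K L - {Idle}"
      using assms by (auto simp: Omega_def)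
    show "\<forall>z\<in>Omega K L - {Idle} - (\<lambda>k. Active k 1) ` {1..K}. rate L \<nu> Idle z * (f z - f Idle) = 0"
      by (auto simp: Omega_def)
  qed (use finite_Omega in auto)
  also have "\<dots> = (\<Sum>k\<in>{1..K}. real (L k) * \<nu> * (along f k 1 - along f k 0))"
    by (subst sum.reindex) (auto simp: inj_on_def)
  finally show ?thesis .
qed

text \<open>
  The integral of \<open>f\<close> with respect to the reversible measure of the star over all states outside
  branch \<open>k\<^sub>2\<close>.
\<close>

definition other_mass :: "nat \<Rightarrow> (nat \<Rightarrow> nat) \<Rightarrow> real \<Rightarrow> nat \<Rightarrow> (state \<Rightarrow> real) \<Rightarrow> real" where
  "other_mass K L \<nu> k\<^sub>2 f = f Idle + (\<Sum>k\<in>{1..K} - {k\<^sub>2}. \<Sum>j=1..L k. weight (L k) \<nu> j * along f k j)"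

text \<open>
  The equation at the idle state supplies the inflow for branch \<open>k\<^sub>2\<close>: every other branch passes
  exactly its own absorbed mass to the idle state.
\<close>

lemma star_passage:
  assumes nu: "0 < \<nu>" and L: "\<forall>k\<in>{1..K}. L k \<ge> 1" and k2: "k\<^sub>2 \<in> {1..K}" "1 \<le> l\<^sub>2" "l\<^sub>2 \<le> L k\<^sub>2"
    and eq: "\<And>x. x \<in> Omega K L - {Active k\<^sub>2 l\<^sub>2} \<Longrightarrow>
      s * f x = (\<Sum>z\<in>Omega K L - {x}. rate L \<nu> x z * (f z - f x))"
  shows "\<And>k l. k \<in> {1..K} - {k\<^sub>2} \<Longrightarrow> l \<le> L k \<Longrightarrow> f Idle - along f k l = s * descent (L k) \<nu> (along f k) l"
    and "\<And>l. l \<le> l\<^sub>2 \<Longrightarrow> along f k\<^sub>2 l - f Idle =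
      s * ascent (L k\<^sub>2) \<nu> (other_mass K L \<nu> k\<^sub>2 f) (along f k\<^sub>2) l"
proof -
  have act: "s * along f k l = (real (L k) - real l) * \<nu> * (along f k (Suc l) - along f k l) +
      real l * (along f k (l - 1) - along f k l)"
    if "k \<in> {1..K}" "1 \<le> l" "l \<le> L k" "(k, l) \<noteq> (k\<^sub>2, l\<^sub>2)" for k l
    using eq[of "Active k l"] generator_Active[where K = K and L = L and k = k and l = l and \<nu> = \<nu> and f = f] that by (auto simp: Omega_def along_pos)
  show "f Idle - along f k l = s * descent (L k) \<nu> (along f k) l" if "k \<in> {1..K} - {k\<^sub>2}" "l \<le> L k" for k l
    using branch_descent[OF nu act[of k] that(2)] that by auto
  have down: "real (L k) * \<nu> * (along f k 1 - along f k 0) = - s * (\<Sum>j=1..L k. weight (L k) \<nu> j * along f k j)"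
    if "k \<in> {1..K} - {k\<^sub>2}" for k
    using branch_descent_flux[of "L k" s "along f k" \<nu> 1, OF act] that L by (auto simp: weight_def algebra_simps)
  have "s * f Idle = (\<Sum>k\<in>{1..K}. real (L k) * \<nu> * (along f k 1 - along f k 0))"
    using eq[of Idle] generator_Idle[OF L, of \<nu> f] by (simp add: Omega_def)
  also have "\<dots> = real (L k\<^sub>2) * \<nu> * (along f k\<^sub>2 1 - along f k\<^sub>2 0) +
      (\<Sum>k\<in>{1..K} - {k\<^sub>2}. - s * (\<Sum>j=1..L k. weight (L k) \<nu> j * along f k j))"
    using k2 down by (subst sum.remove[of _ k\<^sub>2]) auto
  finally have inflow: "real (L k\<^sub>2) * \<nu> * (along f k\<^sub>2 1 - along f k\<^sub>2 0) = s * other_mass K L \<nu> k\<^sub>2 f"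
    by (simp add: other_mass_def algebra_simps sum_distrib_left sum_negf)
  show "along f k\<^sub>2 l - f Idle = s * ascent (L k\<^sub>2) \<nu> (other_mass K L \<nu> k\<^sub>2 f) (along f k\<^sub>2) l"
    if "l \<le> l\<^sub>2" for l
    using branch_ascent[OF nu act[of k\<^sub>2] inflow k2(3) that] k2 by auto
qed

lemma tendsto_descent:
  assumes "0 < \<nu>" "l \<le> n" "\<And>j. 1 \<le> j \<Longrightarrow> j \<le> n \<Longrightarrow> ((\<lambda>i. g i j) \<longlongrightarrow> g' j) F"
  shows "((\<lambda>i. descent n \<nu> (g i) l) \<longlongrightarrow> descent n \<nu> g' l) F"
  unfolding descent_def
proof (intro tendsto_sum tendsto_divide tendsto_mult tendsto_const)
  fix i assume "i \<in> {1..l}"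
  then show "real i * weight n \<nu> i \<noteq> 0" using assms weight_pos[of \<nu> i n] by auto
qed (use assms in auto)

lemma tendsto_ascent:
  assumes "0 < \<nu>" "l \<le> n" "(r \<longlongrightarrow> r') F" "\<And>j. 1 \<le> j \<Longrightarrow> j < l \<Longrightarrow> ((\<lambda>i. g i j) \<longlongrightarrow> g' j) F"
  shows "((\<lambda>i. ascent n \<nu> (r i) (g i) l) \<longlongrightarrow> ascent n \<nu> r' g' l) F"
  unfolding ascent_def
proof (intro tendsto_sum tendsto_divide tendsto_add tendsto_mult tendsto_const)
  fix i assume "i \<in> {1..l}"
  then show "real i * weight n \<nu> i \<noteq> 0" using assms weight_pos[of \<nu> i n] by auto
qed (use assms in auto)

text \<open>
  With this functional the identities of \<open>star_passage\<close> read \<open>1 - f x\<^sub>0 = s * passage_functional f\<close> at the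
  starting state \<open>x\<^sub>0\<close>. Its value at the constant \<open>1\<close> is the mean passage time.
\<close>

definition passage_functional ::
    "nat \<Rightarrow> (nat \<Rightarrow> nat) \<Rightarrow> real \<Rightarrow> nat \<Rightarrow> nat \<Rightarrow> nat \<Rightarrow> nat \<Rightarrow> (state \<Rightarrow> real) \<Rightarrow> real" where
  "passage_functional K L \<nu> k\<^sub>1 l\<^sub>1 k\<^sub>2 l\<^sub>2 f =
     ascent (L k\<^sub>2) \<nu> (other_mass K L \<nu> k\<^sub>2 f) (along f k\<^sub>2) l\<^sub>2 + descent (L k\<^sub>1) \<nu> (along f k\<^sub>1) l\<^sub>1"

lemma along_bounds:
  assumes "\<And>x. x \<in> Omega K L \<Longrightarrow> 0 \<le> f x \<and> f x \<le> 1" "k \<in> {1..K}" "j \<le> L k"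
  shows "0 \<le> along f k j \<and> along f k j \<le> 1"
  using assms by (cases j) (auto simp: Omega_def)

lemma along_const [simp]: "along (\<lambda>_. c) k = (\<lambda>_. c)"
proof
  show "along (\<lambda>_. c) k j = c" for j by (cases j) auto
qed

text \<open>
  What is retained of the transform of the passage time from here on: the bounds, the boundary value
  and the integrated equations.
\<close>

definition passage_transform ::
    "nat \<Rightarrow> (nat \<Rightarrow> nat) \<Rightarrow> real \<Rightarrow> nat \<Rightarrow> nat \<Rightarrow> real \<Rightarrow> (state \<Rightarrow> real) \<Rightarrow> bool" where
  "passage_transform K L \<nu> k\<^sub>2 l\<^sub>2 s f \<longleftrightarrow>
     (\<forall>x\<in>Omega K L. 0 \<le> f x \<and> f x \<le> 1) \<and>
     (\<forall>k\<in>{1..K} - {k\<^sub>2}. \<forall>l\<le>L k. f Idle - along f k l = s * descent (L k) \<nu> (along f k) l) \<and>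
     (\<forall>l\<le>l\<^sub>2. along f k\<^sub>2 l - f Idle =
       s * ascent (L k\<^sub>2) \<nu> (other_mass K L \<nu> k\<^sub>2 f) (along f k\<^sub>2) l) \<and>
     along f k\<^sub>2 l\<^sub>2 = 1"

lemma passage_transformD:
  assumes "passage_transform K L \<nu> k\<^sub>2 l\<^sub>2 s f"
  shows "\<And>x. x \<in> Omega K L \<Longrightarrow> 0 \<le> f x \<and> f x \<le> 1"
    and "\<And>k l. k \<in> {1..K} - {k\<^sub>2} \<Longrightarrow> l \<le> L k \<Longrightarrow> f Idle - along f k l = s * descent (L k) \<nu> (along f k) l"
    and "\<And>l. l \<le> l\<^sub>2 \<Longrightarrow> along f k\<^sub>2 l - f Idle =
      s * ascent (L k\<^sub>2) \<nu> (other_mass K L \<nu> k\<^sub>2 f) (along f k\<^sub>2) l"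
    and "along f k\<^sub>2 l\<^sub>2 = 1"
  using assms unfolding passage_transform_def by blast+

lemma passage_transform_exists:
  assumes mp: "markov_process P (Omega K L) (rate L \<nu>) (Active k\<^sub>1 l\<^sub>1) X"
    and nu: "0 < \<nu>" and s: "0 < s" and L: "\<forall>k\<in>{1..K}. L k \<ge> 1"
    and k: "k\<^sub>1 \<in> {1..K}" "k\<^sub>2 \<in> {1..K}" "k\<^sub>1 \<noteq> k\<^sub>2"
    and l: "0 < l\<^sub>1" "l\<^sub>1 \<le> L k\<^sub>1" "0 < l\<^sub>2" "l\<^sub>2 \<le> L k\<^sub>2"
  shows "\<exists>f. passage_transform K L \<nu> k\<^sub>2 l\<^sub>2 s f \<and>
    along f k\<^sub>1 l\<^sub>1 = (\<integral>w. exp_decay s (first_passage_time X (Active k\<^sub>2 l\<^sub>2) w) \<partial>P)"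
proof -
  have mem: "Active k\<^sub>1 l\<^sub>1 \<in> Omega K L" "Active k\<^sub>2 l\<^sub>2 \<in> Omega K L" "Active k\<^sub>1 l\<^sub>1 \<noteq> Active k\<^sub>2 l\<^sub>2"
    using k l by (auto simp: Omega_def)
  show ?thesis
  proof (rule first_passage_transform[OF mp mem(1,3,2) s])
    fix f assume f: "\<And>x. x \<in> Omega K L \<Longrightarrow> 0 \<le> f x \<and> f x \<le> 1" "f (Active k\<^sub>2 l\<^sub>2) = 1"
      and eq: "\<And>x. x \<in> Omega K L - {Active k\<^sub>2 l\<^sub>2} \<Longrightarrow>
        s * f x = (\<Sum>z\<in>Omega K L - {x}. rate L \<nu> x z * (f z - f x))"
      and start: "f (Active k\<^sub>1 l\<^sub>1) = (\<integral>w. exp_decay s (first_passage_time X (Active k\<^sub>2 l\<^sub>2) w) \<partial>P)"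
    have l2: "1 \<le> l\<^sub>2" using l by simp
    note sp = star_passage[OF nu L k(2) l2 l(4) eq]
    show ?thesis
      unfolding passage_transform_def
    proof (intro exI[of _ f] conjI ballI allI impI)
      show "along f k\<^sub>2 l\<^sub>2 = 1"
        "along f k\<^sub>1 l\<^sub>1 = (\<integral>w. exp_decay s (first_passage_time X (Active k\<^sub>2 l\<^sub>2) w) \<partial>P)"
        using f start l by (simp_all add: along_pos)
    qed (use f(1) sp in blast)+
  qed
qed

text \<open>
  Since \<open>(1 - f x\<^sub>0) / s\<close> equals the passage functional at \<open>f\<close>, and the coefficients of that functional
  are free of \<open>s\<close>, it suffices that \<open>f\<close> tends to \<open>1\<close> as \<open>s\<close> tends to \<open>0\<close>. This in turn follows from the same
  identities, because \<open>f \<le> 1\<close> bounds all increments by \<open>s\<close> times a constant.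
\<close>

lemma mean_passage_time:
  assumes mp: "markov_process P (Omega K L) (rate L \<nu>) (Active k\<^sub>1 l\<^sub>1) X"
    and nu: "0 < \<nu>" and L: "\<forall>k\<in>{1..K}. L k \<ge> 1"
    and k: "k\<^sub>1 \<in> {1..K}" "k\<^sub>2 \<in> {1..K}" "k\<^sub>1 \<noteq> k\<^sub>2"
    and l: "0 < l\<^sub>1" "l\<^sub>1 \<le> L k\<^sub>1" "0 < l\<^sub>2" "l\<^sub>2 \<le> L k\<^sub>2"
  shows "(\<integral>\<^sup>+w. first_passage_time X (Active k\<^sub>2 l\<^sub>2) w \<partial>P) =
    ennreal (passage_functional K L \<nu> k\<^sub>1 l\<^sub>1 k\<^sub>2 l\<^sub>2 (\<lambda>_. 1))"
proof (rule nn_integral_from_transform)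
  show "prob_space P" using mp by (simp add: markov_process_def)
  show "first_passage_time X (Active k\<^sub>2 l\<^sub>2) \<in> borel_measurable P"
    using mp k l
    by (intro first_passage_time_measurable[where S = "Omega K L"])
       (auto simp: markov_process_def Omega_def)
  define s where "s n = 1 / real (Suc n)" for n
  have s: "0 < s n" for n by (simp add: s_def)
  have s0: "s \<longlonglongrightarrow> 0" using LIMSEQ_inverse_real_of_nat by (simp add: s_def[abs_def] inverse_eq_divide)
  let ?T = "first_passage_time X (Active k\<^sub>2 l\<^sub>2)"
  have "\<exists>f. passage_transform K L \<nu> k\<^sub>2 l\<^sub>2 (s n) f \<and> along f k\<^sub>1 l\<^sub>1 = (\<integral>w. exp_decay (s n) (?T w) \<partial>P)" for n
    by (rule passage_transform_exists[OF mp nu s[of n] L k l])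
  then obtain f where F: "passage_transform K L \<nu> k\<^sub>2 l\<^sub>2 (s n) (f n)"
    and start: "along (f n) k\<^sub>1 l\<^sub>1 = (\<integral>w. exp_decay (s n) (?T w) \<partial>P)" for n
    by metis
  note f = passage_transformD(1)[OF F] and down = passage_transformD(2)[OF F]
    and up = passage_transformD(3)[OF F] and top = passage_transformD(4)[OF F]
  note ab = along_bounds[of K L "f n" for n, OF f]
  have wpos: "0 \<le> weight (L k) \<nu> j" if "j \<le> L k" for k j
    using weight_pos[OF nu that] by simp
  have mass_bounds: "0 \<le> other_mass K L \<nu> k\<^sub>2 (f n) \<and> other_mass K L \<nu> k\<^sub>2 (f n) \<le> other_mass K L \<nu> k\<^sub>2 (\<lambda>_. 1)" for n
    unfolding other_mass_def using f[of Idle n] ab wpos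
    by (auto simp: Omega_def intro!: add_mono sum_mono add_nonneg_nonneg sum_nonneg mult_left_le)
  have f_Idle: "(\<lambda>n. f n Idle) \<longlonglongrightarrow> 1"
  proof -
    define C where "C = ascent (L k\<^sub>2) \<nu> (other_mass K L \<nu> k\<^sub>2 (\<lambda>_. 1)) (\<lambda>_. 1) l\<^sub>2"
    have le: "s n * ascent (L k\<^sub>2) \<nu> (other_mass K L \<nu> k\<^sub>2 (f n)) (along (f n) k\<^sub>2) l\<^sub>2 \<le> s n * C" for n
      unfolding C_def using mass_bounds ab l k
      by (intro mult_left_mono[OF _ less_imp_le[OF s]] ascent_mono nu) auto
    have lo: "1 - s n * C \<le> f n Idle" for n
      using up[of l\<^sub>2 n] top[of n] le[of n] by simp
    have hi: "f n Idle \<le> 1" for n using f[of Idle n] by (simp add: Omega_def)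
    have lim: "(\<lambda>n. 1 - s n * C) \<longlonglongrightarrow> 1 - 0 * C" by (intro tendsto_intros s0)
    show ?thesis
      by (rule tendsto_sandwich[where f = "\<lambda>n. 1 - s n * C" and h = "\<lambda>_. 1"]) (use lo hi lim in simp_all)
  qed
  have f_down: "(\<lambda>n. along (f n) k l) \<longlonglongrightarrow> 1" if k: "k \<in> {1..K} - {k\<^sub>2}" "l \<le> L k" for k l
  proof -
    define C where "C = descent (L k) \<nu> (\<lambda>_. 1) l"
    have le: "s n * descent (L k) \<nu> (along (f n) k) l \<le> s n * C" for n
      unfolding C_def using ab k
      by (intro mult_left_mono[OF _ less_imp_le[OF s]] descent_mono nu) auto
    have lo: "f n Idle - s n * C \<le> along (f n) k l" for n
      using down[OF k, of n] le[of n] by simp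
    have hi: "along (f n) k l \<le> 1" for n using ab[of k l n] k by simp
    have lim: "(\<lambda>n. f n Idle - s n * C) \<longlonglongrightarrow> 1 - 0 * C" by (intro tendsto_intros s0 f_Idle)
    show ?thesis
      by (rule tendsto_sandwich[where f = "\<lambda>n. f n Idle - s n * C" and h = "\<lambda>_. 1"]) (use lo hi lim in simp_all)
  qed
  have f_up: "(\<lambda>n. along (f n) k\<^sub>2 j) \<longlonglongrightarrow> 1" if j: "j < l\<^sub>2" for j
  proof -
    have le: "s n * ascent (L k\<^sub>2) \<nu> 0 (\<lambda>_. 0) j \<le>
        s n * ascent (L k\<^sub>2) \<nu> (other_mass K L \<nu> k\<^sub>2 (f n)) (along (f n) k\<^sub>2) j" for n
      using mass_bounds ab l k j by (intro mult_left_mono[OF _ less_imp_le[OF s]] ascent_mono nu) auto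
    have "ascent (L k\<^sub>2) \<nu> 0 (\<lambda>_. 0) j = 0" by (simp add: ascent_def)
    then have lo: "f n Idle \<le> along (f n) k\<^sub>2 j" for n
      using up[of j n] j le[of n] by simp
    have hi: "along (f n) k\<^sub>2 j \<le> 1" for n using ab[of k\<^sub>2 j n] k l j by simp
    show ?thesis
      by (rule tendsto_sandwich[where f = "\<lambda>n. f n Idle" and h = "\<lambda>_. 1"]) (use f_Idle lo hi in simp_all)
  qed
  have "(\<lambda>n. passage_functional K L \<nu> k\<^sub>1 l\<^sub>1 k\<^sub>2 l\<^sub>2 (f n)) \<longlonglongrightarrow>
      passage_functional K L \<nu> k\<^sub>1 l\<^sub>1 k\<^sub>2 l\<^sub>2 (\<lambda>_. 1)"
    unfolding passage_functional_def other_mass_def along_const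
    by (intro tendsto_add tendsto_ascent tendsto_descent tendsto_sum tendsto_mult tendsto_const
        nu f_Idle f_down f_up) (use k l in simp_all)
  moreover have "passage_functional K L \<nu> k\<^sub>1 l\<^sub>1 k\<^sub>2 l\<^sub>2 (f n) =
      real (Suc n) * (1 - (\<integral>w. exp_decay (1 / real (Suc n)) (?T w) \<partial>P))" for n
  proof -
    have "1 - along (f n) k\<^sub>1 l\<^sub>1 = s n * passage_functional K L \<nu> k\<^sub>1 l\<^sub>1 k\<^sub>2 l\<^sub>2 (f n)"
      using up[of l\<^sub>2 n] down[of k\<^sub>1 l\<^sub>1 n] top[of n] k l
      by (simp add: passage_functional_def algebra_simps)
    then show ?thesis unfolding start s_def by (simp add: field_simps del: of_nat_Suc)
  qed
  ultimately show "(\<lambda>n. real (Suc n) * (1 - (\<integral>w. exp_decay (1 / real (Suc n)) (?T w) \<partial>P)))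
      \<longlonglongrightarrow> passage_functional K L \<nu> k\<^sub>1 l\<^sub>1 k\<^sub>2 l\<^sub>2 (\<lambda>_. 1)" by simp
qed

section \<open>Asymptotics for large activation rates\<close>

text \<open>
  The power of \<open>\<nu>\<close> in each term of \<open>descent\<close> and \<open>ascent\<close> after rescaling by \<open>\<nu>^M\<close> is \<open>j - i - M\<close>, so a
  term either tends to \<open>0\<close> or, when \<open>j = i + M\<close>, keeps a constant coefficient. The factor \<open>x\<close> need only be
  bounded, as the limits of the transforms are not yet known at this stage.
\<close>

lemma weight_quotient_asymptotics:
  assumes i: "1 \<le> i" "i \<le> n" and j: "j \<le> i + M"
    and x: "\<And>\<nu>. 0 < \<nu> \<Longrightarrow> \<bar>x \<nu>\<bar> \<le> 1"
  shows "((\<lambda>\<nu>. weight m \<nu> j * x \<nu> / (real i * weight n \<nu> i) / \<nu> ^ M -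
      (if j = i + M then real (m choose j) / (real i * real (n choose i)) * x \<nu> else 0)) \<longlongrightarrow> 0) at_top"
proof -
  define c where "c = real (m choose j) / (real i * real (n choose i))"
  have c0: "0 \<le> c" by (simp add: c_def)
  have eq: "weight m \<nu> j * x \<nu> / (real i * weight n \<nu> i) / \<nu> ^ M = c * (\<nu> ^ j / \<nu> ^ (i + M)) * x \<nu>" for \<nu>
    by (simp add: c_def weight_def power_add)
  show ?thesis
  proof (cases "j = i + M")
    case True
    have "eventually (\<lambda>\<nu>. weight m \<nu> j * x \<nu> / (real i * weight n \<nu> i) / \<nu> ^ M - c * x \<nu> = 0) at_top"
      using eventually_gt_at_top[of 0] by eventually_elim (subst eq, simp add: True)
    then show ?thesis using True by (auto simp: c_def intro: tendsto_eventually)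
  next
    case False
    then obtain d where d: "i + M = j + Suc d" using j less_imp_Suc_add[of j "i + M"] by auto
    have lim: "((\<lambda>\<nu>. c * (1 / \<nu>)) \<longlongrightarrow> 0) at_top"
      using tendsto_mult[OF tendsto_const[of c] tendsto_inverse_0_at_top[OF filterlim_ident[of at_top]]]
      by (simp add: inverse_eq_divide)
    have "eventually (\<lambda>\<nu>. norm (weight m \<nu> j * x \<nu> / (real i * weight n \<nu> i) / \<nu> ^ M) \<le> c * (1 / \<nu>)) at_top"
      using eventually_ge_at_top[of 1]
    proof eventually_elim
      case (elim \<nu>)
      have "\<nu> ^ j / \<nu> ^ (i + M) = 1 / \<nu> ^ Suc d" using elim by (simp add: d power_add)
      also have "\<dots> \<le> 1 / \<nu>" using elim by (intro divide_left_mono self_le_power) auto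
      finally have "c * (\<nu> ^ j / \<nu> ^ (i + M)) \<le> c * (1 / \<nu>)" by (rule mult_left_mono[OF _ c0])
      moreover have nonneg: "0 \<le> c * (\<nu> ^ j / \<nu> ^ (i + M))" using elim c0 by simp
      have "norm (c * (\<nu> ^ j / \<nu> ^ (i + M)) * x \<nu>) = c * (\<nu> ^ j / \<nu> ^ (i + M)) * \<bar>x \<nu>\<bar>"
        unfolding real_norm_def abs_mult[of _ "x \<nu>"] by (simp only: abs_of_nonneg[OF nonneg])
      moreover have "\<dots> \<le> c * (\<nu> ^ j / \<nu> ^ (i + M))"
        using x[of \<nu>] elim by (intro mult_left_le nonneg) auto
      ultimately show ?case unfolding eq by linarith
    qed
    then have "((\<lambda>\<nu>. weight m \<nu> j * x \<nu> / (real i * weight n \<nu> i) / \<nu> ^ M) \<longlongrightarrow> 0) at_top"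
      by (rule Lim_null_comparison[OF _ lim])
    then show ?thesis using False by simp
  qed
qed

text \<open>
  With \<open>j \<le> n \<le> M + 1\<close> and \<open>i \<ge> 1\<close>, the equation \<open>j = i + M\<close> leaves only the lowest edge \<open>i = 1\<close> and the
  top state \<open>j = n = M + 1\<close>: a branch of maximal size spends its time at its top, and a smaller branch
  takes negligible time.
\<close>

lemma descent_asymptotics:
  assumes l: "1 \<le> l" "l \<le> n" and n: "n \<le> Suc M"
    and g: "\<And>\<nu> j. 0 < \<nu> \<Longrightarrow> j \<le> n \<Longrightarrow> \<bar>g \<nu> j\<bar> \<le> 1"
  shows "((\<lambda>\<nu>. descent n \<nu> (g \<nu>) l / \<nu> ^ M - (if n = Suc M then g \<nu> n / real n else 0)) \<longlongrightarrow> 0) at_top"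
proof -
  define c where "c i j \<nu> = (if j = i + M then real (n choose j) / (real i * real (n choose i)) * g \<nu> j else 0)" for i j \<nu>
  have "((\<lambda>\<nu>. \<Sum>i=1..l. \<Sum>j=i..n. weight n \<nu> j * g \<nu> j / (real i * weight n \<nu> i) / \<nu> ^ M - c i j \<nu>)
      \<longlongrightarrow> (\<Sum>i=1..l. \<Sum>j=i..n. 0)) at_top"
    unfolding c_def
    by (intro tendsto_sum weight_quotient_asymptotics) (use l n g in auto)
  moreover have "(\<Sum>i=1..l. \<Sum>j=i..n. weight n \<nu> j * g \<nu> j / (real i * weight n \<nu> i) / \<nu> ^ M) =
      descent n \<nu> (g \<nu>) l / \<nu> ^ M" for \<nu>
    by (simp add: descent_def sum_divide_distrib)
  moreover have "(\<Sum>i=1..l. \<Sum>j=i..n. c i j \<nu>) = (if n = Suc M then g \<nu> n / real n else 0)" for \<nu>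
  proof -
    have "(\<Sum>i=1..l. \<Sum>j=i..n. c i j \<nu>) = (\<Sum>i\<in>{1}. \<Sum>j=i..n. c i j \<nu>)"
      using l n by (intro sum.mono_neutral_right ballI sum.neutral) (auto simp: c_def)
    also have "\<dots> = (\<Sum>j=1..n. if j = Suc M then real (n choose j) / real n * g \<nu> j else 0)"
      by (simp add: c_def)
    also have "\<dots> = (if n = Suc M then g \<nu> n / real n else 0)"
      using n by (auto simp: sum.delta)
    finally show ?thesis .
  qed
  ultimately show ?thesis by (simp add: sum_subtractf)
qed

text \<open>
  Again only the lowest edge and the tops of the branches of size \<open>M + 1\<close> survive: once branch \<open>k\<^sub>2\<close>
  is entered, the target is reached at no cost.
\<close>

lemma ascent_asymptotics:
  assumes l: "1 \<le> l" "l \<le> n" and A: "finite A" "\<And>k. k \<in> A \<Longrightarrow> L k \<le> Suc M"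
    and g: "\<And>\<nu> j. 0 < \<nu> \<Longrightarrow> j \<le> n \<Longrightarrow> \<bar>g \<nu> j\<bar> \<le> 1" and v: "\<And>\<nu>. 0 < \<nu> \<Longrightarrow> \<bar>v \<nu>\<bar> \<le> 1"
    and f: "\<And>\<nu> k j. 0 < \<nu> \<Longrightarrow> k \<in> A \<Longrightarrow> j \<le> L k \<Longrightarrow> \<bar>f \<nu> k j\<bar> \<le> 1"
  shows "((\<lambda>\<nu>. ascent n \<nu> (v \<nu> + (\<Sum>k\<in>A. \<Sum>j=1..L k. weight (L k) \<nu> j * f \<nu> k j)) (g \<nu>) l / \<nu> ^ M -
      (\<Sum>k | k \<in> A \<and> L k = Suc M. f \<nu> k (Suc M)) / real n) \<longlongrightarrow> 0) at_top"
proof -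
  define c where "c i k j \<nu> = (if j = i + M then real (L k choose j) / (real i * real (n choose i)) * f \<nu> k j else 0)" for i k j \<nu>
  \<comment> \<open>The idle state is written as the bottom of an empty branch, so that one lemma treats all terms.\<close>
  have "((\<lambda>\<nu>. \<Sum>i=1..l. (weight 0 \<nu> 0 * v \<nu> / (real i * weight n \<nu> i) / \<nu> ^ M -
          (if 0 = i + M then real (0 choose 0) / (real i * real (n choose i)) * v \<nu> else 0)) +
      (\<Sum>k\<in>A. \<Sum>j=1..L k. weight (L k) \<nu> j * f \<nu> k j / (real i * weight n \<nu> i) / \<nu> ^ M - c i k j \<nu>) +
      (\<Sum>j=1..<i. weight n \<nu> j * g \<nu> j / (real i * weight n \<nu> i) / \<nu> ^ M -
          (if j = i + M then real (n choose j) / (real i * real (n choose i)) * g \<nu> j else 0)))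
      \<longlongrightarrow> (\<Sum>i=1..l. 0 + (\<Sum>k\<in>A. \<Sum>j=1..L k. 0) + (\<Sum>j=1..<i. 0))) at_top"
    unfolding c_def
    by (intro tendsto_sum tendsto_add weight_quotient_asymptotics) (use l v f g in \<open>auto dest!: A(2)\<close>)
  also have "(\<lambda>\<nu>. \<Sum>i=1..l. (weight 0 \<nu> 0 * v \<nu> / (real i * weight n \<nu> i) / \<nu> ^ M -
          (if 0 = i + M then real (0 choose 0) / (real i * real (n choose i)) * v \<nu> else 0)) +
      (\<Sum>k\<in>A. \<Sum>j=1..L k. weight (L k) \<nu> j * f \<nu> k j / (real i * weight n \<nu> i) / \<nu> ^ M - c i k j \<nu>) +
      (\<Sum>j=1..<i. weight n \<nu> j * g \<nu> j / (real i * weight n \<nu> i) / \<nu> ^ M -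
          (if j = i + M then real (n choose j) / (real i * real (n choose i)) * g \<nu> j else 0))) =
    (\<lambda>\<nu>. (\<Sum>i=1..l. (v \<nu> + (\<Sum>k\<in>A. \<Sum>j=1..L k. weight (L k) \<nu> j * f \<nu> k j) + (\<Sum>j=1..<i. weight n \<nu> j * g \<nu> j)) /
        (real i * weight n \<nu> i) / \<nu> ^ M - (\<Sum>k\<in>A. \<Sum>j=1..L k. c i k j \<nu>)))"
    by (intro ext sum.cong refl)
       (simp add: weight_def[of 0] sum_subtractf sum_divide_distrib add_divide_distrib)
  also have "\<dots> = (\<lambda>\<nu>. ascent n \<nu> (v \<nu> + (\<Sum>k\<in>A. \<Sum>j=1..L k. weight (L k) \<nu> j * f \<nu> k j)) (g \<nu>) l / \<nu> ^ M -
      (\<Sum>i=1..l. \<Sum>k\<in>A. \<Sum>j=1..L k. c i k j \<nu>))"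
    by (simp add: ascent_def sum_subtractf sum_divide_distrib)
  also have "(\<lambda>\<nu>. \<Sum>i=1..l. \<Sum>k\<in>A. \<Sum>j=1..L k. c i k j \<nu>) =
      (\<lambda>\<nu>. (\<Sum>k | k \<in> A \<and> L k = Suc M. f \<nu> k (Suc M)) / real n)"
  proof
    fix \<nu>
    have "(\<Sum>i=1..l. \<Sum>k\<in>A. \<Sum>j=1..L k. c i k j \<nu>) = (\<Sum>i\<in>{1}. \<Sum>k\<in>A. \<Sum>j=1..L k. c i k j \<nu>)"
      using l by (intro sum.mono_neutral_right ballI sum.neutral) (auto simp: c_def dest!: A(2))
    also have "\<dots> = (\<Sum>k\<in>A. \<Sum>j=1..L k. if j = Suc M then real (L k choose j) / real n * f \<nu> k j else 0)"
      by (simp add: c_def cong: if_cong)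
    also have "\<dots> = (\<Sum>k\<in>A. if L k = Suc M then f \<nu> k (Suc M) / real n else 0)"
      by (intro sum.cong refl) (auto simp: sum.delta dest!: A(2))
    also have "\<dots> = (\<Sum>k | k \<in> A \<and> L k = Suc M. f \<nu> k (Suc M) / real n)"
      using A(1) by (simp add: sum.inter_filter)
    finally show "(\<Sum>i=1..l. \<Sum>k\<in>A. \<Sum>j=1..L k. c i k j \<nu>) =
        (\<Sum>k | k \<in> A \<and> L k = Suc M. f \<nu> k (Suc M)) / real n"
      by (simp add: sum_divide_distrib)
  qed
  finally show ?thesis by simp
qed

text \<open>
  The factor \<open>u\<close> may be replaced by its limit and \<open>A\<close> by \<open>B\<close> even when neither \<open>A\<close> nor \<open>B\<close> converges.
\<close>

lemma tendsto_mult_difference: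
  fixes u A B :: "'a \<Rightarrow> real"
  assumes u: "(u \<longlongrightarrow> c) F" and AB: "((\<lambda>i. A i - B i) \<longlongrightarrow> 0) F" and B: "eventually (\<lambda>i. \<bar>B i\<bar> \<le> b) F"
  shows "((\<lambda>i. u i * A i - c * B i) \<longlongrightarrow> 0) F"
proof -
  have "((\<lambda>i. u i - c) \<longlongrightarrow> 0) F" using tendsto_diff[OF u tendsto_const[of c]] by simp
  then have "((\<lambda>i. (u i - c) * b) \<longlongrightarrow> 0) F" by (rule tendsto_mult_left_zero)
  then have "((\<lambda>i. \<bar>(u i - c) * b\<bar>) \<longlongrightarrow> 0) F" by (rule tendsto_rabs_zero)
  moreover have "eventually (\<lambda>i. norm ((u i - c) * B i) \<le> \<bar>(u i - c) * b\<bar>) F"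
    using B by eventually_elim (simp add: abs_mult mult_left_mono)
  ultimately have "((\<lambda>i. (u i - c) * B i) \<longlongrightarrow> 0) F" by (rule Lim_null_comparison[rotated])
  from tendsto_add[OF tendsto_mult[OF u AB] this]
  show ?thesis by (simp add: algebra_simps)
qed

text \<open>
  Let \<open>F\<^sub>0\<close> be the transform at the idle state, \<open>F\<^sub>k\<close> the one at the top of a dominant branch, \<open>N = M + 1\<close> and
  \<open>a = \<sigma> / N\<close>. In the limit the identities reduce to \<open>F\<^sub>0 - F\<^sub>k = a F\<^sub>k\<close> and
  \<open>1 - F\<^sub>0 = \<sigma> (\<Sum>k\<in>K\<^sub>*. F\<^sub>k) / L k\<^sub>2\<close>. Neither \<open>F\<^sub>0\<close> nor \<open>F\<^sub>k\<close> is known to converge beforehand, so the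
  relations are stated as null sequences and \<open>F\<^sub>k\<close> is eliminated before passing to the limit.
\<close>

lemma transform_limit:
  assumes k: "k\<^sub>1 \<in> {1..K}" "k\<^sub>2 \<in> {1..K}" "k\<^sub>1 \<noteq> k\<^sub>2"
    and l: "0 < l\<^sub>1" "l\<^sub>1 \<le> L k\<^sub>1" "0 < l\<^sub>2" "l\<^sub>2 \<le> L k\<^sub>2"
    and N: "L_star K L k\<^sub>2 = Suc M"
    and f: "\<And>\<nu>. 0 < \<nu> \<Longrightarrow> passage_transform K L \<nu> k\<^sub>2 l\<^sub>2 (s \<nu>) (f \<nu>)"
    and s: "((\<lambda>\<nu>. s \<nu> * \<nu> ^ M) \<longlongrightarrow> \<sigma>) at_top" and \<sigma>: "0 \<le> \<sigma>"
  shows "((\<lambda>\<nu>. along (f \<nu>) k\<^sub>1 l\<^sub>1) \<longlongrightarrow>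
    1 / (1 + \<sigma> * real (card (K_star K L k\<^sub>2)) / (real (L k\<^sub>2) * (1 + \<sigma> / real (Suc M)))) *
    (if k\<^sub>1 \<in> K_star K L k\<^sub>2 then 1 / (1 + \<sigma> / real (Suc M)) else 1)) at_top"
proof -
  define A where "A = {1..K} - {k\<^sub>2}"
  have KS: "K_star K L k\<^sub>2 = {k. k \<in> A \<and> L k = Suc M}"
    by (auto simp: K_star_def A_def N)
  have L_le: "L k \<le> Suc M" if "k \<in> A" for k
    unfolding N[symmetric] L_star_def using that by (intro Max_ge) (auto simp: A_def)
  have bound: "\<bar>along (f \<nu>) k j\<bar> \<le> 1" if "0 < \<nu>" "k \<in> {1..K}" "j \<le> L k" for \<nu> k j
    using along_bounds[where K = K and L = L and f = "f \<nu>" and k = k and j = j]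
      passage_transformD(1)[OF f[OF that(1)]] that by (auto simp: abs_le_iff)
  have bound0: "\<bar>f \<nu> Idle\<bar> \<le> 1" if "0 < \<nu>" for \<nu>
    using bound[OF that k(1), of 0] by simp
  define F0 where "F0 \<nu> = f \<nu> Idle" for \<nu>
  define F where "F k \<nu> = along (f \<nu>) k (Suc M)" for k \<nu>
  define a where "a = \<sigma> / real (Suc M)"
  define \<kappa> where "\<kappa> = real (card (K_star K L k\<^sub>2))"
  have a0: "0 \<le> a" using \<sigma> by (simp add: a_def)
  have pos: "eventually (\<lambda>\<nu>. 0 < \<nu>) (at_top :: real filter)" by (rule eventually_gt_at_top)
  have fall: "((\<lambda>\<nu>. F0 \<nu> - along (f \<nu>) k l - (if L k = Suc M then a * F k \<nu> else 0)) \<longlongrightarrow> 0) at_top"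
    if kl: "k \<in> A" "1 \<le> l" "l \<le> L k" for k l
  proof -
    have "((\<lambda>\<nu>. s \<nu> * \<nu> ^ M * (descent (L k) \<nu> (along (f \<nu>) k) l / \<nu> ^ M) -
        \<sigma> * (if L k = Suc M then along (f \<nu>) k (L k) / real (L k) else 0)) \<longlongrightarrow> 0) at_top"
    proof (rule tendsto_mult_difference[OF s descent_asymptotics, where b = 1])
      show "\<forall>\<^sub>F \<nu> in at_top. \<bar>if L k = Suc M then along (f \<nu>) k (L k) / real (L k) else 0\<bar> \<le> 1"
        using pos
      proof eventually_elim
        case (elim \<nu>)
        then show ?case using bound[of \<nu> k "L k"] kl by (auto simp: A_def abs_divide field_simps)
      qed
    qed (use kl L_le bound in \<open>auto simp: A_def\<close>)
    moreover have "\<forall>\<^sub>F \<nu> in at_top. s \<nu> * \<nu> ^ M * (descent (L k) \<nu> (along (f \<nu>) k) l / \<nu> ^ M) -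
        \<sigma> * (if L k = Suc M then along (f \<nu>) k (L k) / real (L k) else 0) =
        F0 \<nu> - along (f \<nu>) k l - (if L k = Suc M then a * F k \<nu> else 0)"
      using pos
    proof eventually_elim
      case (elim \<nu>)
      then show ?case
        using passage_transformD(2)[OF f[OF elim], of k l] kl by (simp add: A_def F0_def F_def a_def)
    qed
    ultimately show ?thesis by (rule Lim_transform_eventually)
  qed
  have top_F: "((\<lambda>\<nu>. F0 \<nu> / (1 + a) - F k \<nu>) \<longlongrightarrow> 0) at_top" if "k \<in> K_star K L k\<^sub>2" for k
  proof -
    have "((\<lambda>\<nu>. F0 \<nu> - F k \<nu> - a * F k \<nu>) \<longlongrightarrow> 0) at_top"
      using fall[of k "Suc M"] that by (simp add: KS F_def)
    from tendsto_divide[OF this tendsto_const[of "1 + a"]] a0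
    have "((\<lambda>\<nu>. (F0 \<nu> - F k \<nu> - a * F k \<nu>) / (1 + a)) \<longlongrightarrow> 0) at_top" by simp
    moreover have "(F0 \<nu> - F k \<nu> - a * F k \<nu>) / (1 + a) = F0 \<nu> / (1 + a) - F k \<nu>" for \<nu>
      using a0 by (simp add: field_simps)
    ultimately show ?thesis by simp
  qed
  have n0: "0 < real (L k\<^sub>2)" using l by simp
  have rise: "((\<lambda>\<nu>. 1 - F0 \<nu> - \<sigma> * ((\<Sum>k\<in>K_star K L k\<^sub>2. F k \<nu>) / real (L k\<^sub>2))) \<longlongrightarrow> 0) at_top"
  proof -
    have "((\<lambda>\<nu>. s \<nu> * \<nu> ^ M * (ascent (L k\<^sub>2) \<nu> (f \<nu> Idle + (\<Sum>k\<in>A. \<Sum>j=1..L k. weight (L k) \<nu> j * along (f \<nu>) k j))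
          (along (f \<nu>) k\<^sub>2) l\<^sub>2 / \<nu> ^ M) -
        \<sigma> * ((\<Sum>k | k \<in> A \<and> L k = Suc M. along (f \<nu>) k (Suc M)) / real (L k\<^sub>2))) \<longlongrightarrow> 0) at_top"
    proof (rule tendsto_mult_difference[OF s ascent_asymptotics, where b = "\<kappa> / real (L k\<^sub>2)"])
      show "\<forall>\<^sub>F \<nu> in at_top. \<bar>(\<Sum>k | k \<in> A \<and> L k = Suc M. along (f \<nu>) k (Suc M)) / real (L k\<^sub>2)\<bar> \<le> \<kappa> / real (L k\<^sub>2)"
        using pos
      proof eventually_elim
        case (elim \<nu>)
        have "\<bar>\<Sum>k | k \<in> A \<and> L k = Suc M. along (f \<nu>) k (Suc M)\<bar> \<le> (\<Sum>k | k \<in> A \<and> L k = Suc M. 1)"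
          using bound[OF elim] by (intro order_trans[OF sum_abs] sum_mono) (auto simp: A_def simp del: along.simps)
        then show ?case by (simp add: abs_divide divide_right_mono \<kappa>_def KS)
      qed
    qed (use l k L_le bound bound0 in \<open>auto simp: A_def\<close>)
    moreover have "\<forall>\<^sub>F \<nu> in at_top. s \<nu> * \<nu> ^ M *
        (ascent (L k\<^sub>2) \<nu> (f \<nu> Idle + (\<Sum>k\<in>A. \<Sum>j=1..L k. weight (L k) \<nu> j * along (f \<nu>) k j))
          (along (f \<nu>) k\<^sub>2) l\<^sub>2 / \<nu> ^ M) -
        \<sigma> * ((\<Sum>k | k \<in> A \<and> L k = Suc M. along (f \<nu>) k (Suc M)) / real (L k\<^sub>2)) =
        1 - F0 \<nu> - \<sigma> * ((\<Sum>k\<in>K_star K L k\<^sub>2. F k \<nu>) / real (L k\<^sub>2))"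
      using pos
    proof eventually_elim
      case (elim \<nu>)
      then show ?case
        using passage_transformD(3)[OF f[OF elim], of l\<^sub>2] passage_transformD(4)[OF f[OF elim]]
        by (simp add: other_mass_def A_def F0_def F_def KS)
    qed
    ultimately show ?thesis by (rule Lim_transform_eventually)
  qed
  define \<delta> where "\<delta> = 1 + \<sigma> * \<kappa> / (real (L k\<^sub>2) * (1 + a))"
  have \<delta>: "1 \<le> \<delta>" using a0 \<sigma> n0 by (simp add: \<delta>_def \<kappa>_def)
  have lim: "((\<lambda>\<nu>. (1 - F0 \<nu> - \<sigma> * ((\<Sum>k\<in>K_star K L k\<^sub>2. F k \<nu>) / real (L k\<^sub>2))) -
      \<sigma> * ((\<Sum>k\<in>K_star K L k\<^sub>2. F0 \<nu> / (1 + a) - F k \<nu>) / real (L k\<^sub>2)))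
      \<longlongrightarrow> 0 - \<sigma> * ((\<Sum>k\<in>K_star K L k\<^sub>2. 0) / real (L k\<^sub>2))) at_top"
    by (intro tendsto_diff rise tendsto_mult tendsto_divide tendsto_sum tendsto_const top_F) (use n0 in auto)
  have eq: "(1 - F0 \<nu> - \<sigma> * ((\<Sum>k\<in>K_star K L k\<^sub>2. F k \<nu>) / real (L k\<^sub>2))) -
      \<sigma> * ((\<Sum>k\<in>K_star K L k\<^sub>2. F0 \<nu> / (1 + a) - F k \<nu>) / real (L k\<^sub>2)) = 1 - \<delta> * F0 \<nu>" for \<nu>
  proof -
    have sum_eq: "(\<Sum>k\<in>K_star K L k\<^sub>2. F0 \<nu> / (1 + a) - F k \<nu>) =
        \<kappa> * (F0 \<nu> / (1 + a)) - (\<Sum>k\<in>K_star K L k\<^sub>2. F k \<nu>)"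
      by (simp add: sum_subtractf \<kappa>_def)
    have alg: "(1 - x - \<sigma> * (S / m)) - \<sigma> * ((\<kappa> * (x / (1 + a)) - S) / m) = 1 - (1 + \<sigma> * \<kappa> / (m * (1 + a))) * x"
      if "0 < m" for x S m :: real
      using that by (simp add: diff_divide_distrib algebra_simps)
    show ?thesis unfolding sum_eq \<delta>_def by (rule alg[OF n0])
  qed
  have "((\<lambda>\<nu>. 1 - \<delta> * F0 \<nu>) \<longlongrightarrow> 0) at_top" using lim unfolding eq by simp
  from tendsto_divide[OF tendsto_diff[OF tendsto_const[of 1] this] tendsto_const[of \<delta>]]
  have F0_lim: "(F0 \<longlongrightarrow> 1 / \<delta>) at_top" using \<delta> by simp
  have k1: "k\<^sub>1 \<in> A" using k by (simp add: A_def)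
  have l1: "1 \<le> l\<^sub>1" using l by simp
  have "((\<lambda>\<nu>. along (f \<nu>) k\<^sub>1 l\<^sub>1) \<longlongrightarrow> 1 / \<delta> * (if k\<^sub>1 \<in> K_star K L k\<^sub>2 then 1 / (1 + a) else 1)) at_top"
  proof (cases "k\<^sub>1 \<in> K_star K L k\<^sub>2")
    case True
    then have Lk: "L k\<^sub>1 = Suc M" by (simp add: KS)
    have "((\<lambda>\<nu>. F0 \<nu> - a * (F0 \<nu> / (1 + a) - (F0 \<nu> / (1 + a) - F k\<^sub>1 \<nu>)) -
        (F0 \<nu> - along (f \<nu>) k\<^sub>1 l\<^sub>1 - (if L k\<^sub>1 = Suc M then a * F k\<^sub>1 \<nu> else 0))) \<longlongrightarrow>
        1 / \<delta> - a * (1 / \<delta> / (1 + a) - 0) - 0) at_top"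
      using a0 by (intro tendsto_diff tendsto_mult tendsto_const tendsto_divide F0_lim top_F[OF True]
        fall[OF k1 l1 l(2)]) auto
    moreover have "y - a * (y / (1 + a) - 0) - 0 = y * (1 / (1 + a))" for y
      using a0 by (simp add: field_simps)
    ultimately have "((\<lambda>\<nu>. along (f \<nu>) k\<^sub>1 l\<^sub>1) \<longlongrightarrow> 1 / \<delta> * (1 / (1 + a))) at_top"
      using Lk by (simp only: if_True refl) (simp add: Lk)
    then show ?thesis using True by simp
  next
    case False
    then have Lk: "L k\<^sub>1 \<noteq> Suc M" using k1 by (simp add: KS)
    from tendsto_diff[OF F0_lim fall[OF k1 l1 l(2)]] show ?thesis using False Lk by simp
  qed
  then show ?thesis by (simp only: \<delta>_def \<kappa>_def a_def)
qed

text \<open>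
  The time scale of the passage, obtained from the same asymptotics with the constant \<open>1\<close> in place of
  the transforms.
\<close>

lemma mean_limit:
  assumes k: "k\<^sub>1 \<in> {1..K}" "k\<^sub>2 \<in> {1..K}" "k\<^sub>1 \<noteq> k\<^sub>2"
    and l: "0 < l\<^sub>1" "l\<^sub>1 \<le> L k\<^sub>1" "0 < l\<^sub>2" "l\<^sub>2 \<le> L k\<^sub>2"
    and N: "L_star K L k\<^sub>2 = Suc M"
  shows "((\<lambda>\<nu>. passage_functional K L \<nu> k\<^sub>1 l\<^sub>1 k\<^sub>2 l\<^sub>2 (\<lambda>_. 1) / \<nu> ^ M) \<longlongrightarrow>
    real (card (K_star K L k\<^sub>2)) / real (L k\<^sub>2) + (if k\<^sub>1 \<in> K_star K L k\<^sub>2 then 1 / real (Suc M) else 0)) at_top"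
proof -
  define A where "A = {1..K} - {k\<^sub>2}"
  have KS: "K_star K L k\<^sub>2 = {k. k \<in> A \<and> L k = Suc M}"
    by (auto simp: K_star_def A_def N)
  have L_le: "L k \<le> Suc M" if "k \<in> A" for k
    unfolding N[symmetric] L_star_def using that by (intro Max_ge) (auto simp: A_def)
  have up: "((\<lambda>\<nu>. ascent (L k\<^sub>2) \<nu> (1 + (\<Sum>k\<in>A. \<Sum>j=1..L k. weight (L k) \<nu> j * 1)) (\<lambda>_. 1) l\<^sub>2 / \<nu> ^ M -
      (\<Sum>k | k \<in> A \<and> L k = Suc M. 1) / real (L k\<^sub>2)) \<longlongrightarrow> 0) at_top"
    by (rule ascent_asymptotics[where v = "\<lambda>_. 1" and g = "\<lambda>_ _. 1" and f = "\<lambda>_ _ _. 1"])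
       (use l L_le in \<open>auto simp: A_def\<close>)
  have down: "((\<lambda>\<nu>. descent (L k\<^sub>1) \<nu> (\<lambda>_. 1) l\<^sub>1 / \<nu> ^ M - (if L k\<^sub>1 = Suc M then 1 / real (L k\<^sub>1) else 0)) \<longlongrightarrow> 0) at_top"
    by (rule descent_asymptotics[where g = "\<lambda>_ _. 1"]) (use l k L_le in \<open>auto simp: A_def\<close>)
  have "L k\<^sub>1 = Suc M \<longleftrightarrow> k\<^sub>1 \<in> K_star K L k\<^sub>2" using k by (auto simp: KS A_def)
  then have c: "(\<Sum>k | k \<in> A \<and> L k = Suc M. 1) / real (L k\<^sub>2) + (if L k\<^sub>1 = Suc M then 1 / real (L k\<^sub>1) else 0) =
      real (card (K_star K L k\<^sub>2)) / real (L k\<^sub>2) + (if k\<^sub>1 \<in> K_star K L k\<^sub>2 then 1 / real (Suc M) else 0)"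
    by (simp add: KS)
  from tendsto_add[OF tendsto_add[OF up down] tendsto_const[of "(\<Sum>k | k \<in> A \<and> L k = Suc M. 1) / real (L k\<^sub>2) + (if L k\<^sub>1 = Suc M then 1 / real (L k\<^sub>1) else 0)"]]
  show ?thesis
    unfolding c[symmetric] by (simp add: passage_functional_def other_mass_def A_def add_divide_distrib)
qed

lemma passage_functional_pos:
  assumes nu: "0 < \<nu>" and l: "0 < l\<^sub>1" "l\<^sub>1 \<le> L k\<^sub>1" "l\<^sub>2 \<le> L k\<^sub>2"
  shows "0 < passage_functional K L \<nu> k\<^sub>1 l\<^sub>1 k\<^sub>2 l\<^sub>2 (\<lambda>_. 1)"
proof -
  have w: "0 < weight (L k) \<nu> j" if "j \<le> L k" for k j by (rule weight_pos[OF nu that])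
  have "0 < descent (L k\<^sub>1) \<nu> (\<lambda>_. 1) l\<^sub>1"
    unfolding descent_def using l w by (auto intro!: sum_pos divide_pos_pos mult_pos_pos)
  moreover have "0 \<le> other_mass K L \<nu> k\<^sub>2 (\<lambda>_. 1)"
    unfolding other_mass_def along_const
    by (intro add_nonneg_nonneg sum_nonneg mult_nonneg_nonneg less_imp_le[OF w]) auto
  then have "ascent (L k\<^sub>2) \<nu> 0 (\<lambda>_. 0) l\<^sub>2 \<le> ascent (L k\<^sub>2) \<nu> (other_mass K L \<nu> k\<^sub>2 (\<lambda>_. 1)) (\<lambda>_. 1) l\<^sub>2"
    using l by (intro ascent_mono nu) auto
  moreover have "ascent (L k\<^sub>2) \<nu> 0 (\<lambda>_. 0) l\<^sub>2 = 0" by (simp add: ascent_def)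
  ultimately show ?thesis by (simp add: passage_functional_def comp_def)
qed

section \<open>Geometric sums of exponential variables\<close>

lemma exponential_nonneg:
  assumes Q: "prob_space Q" and Y: "distributed Q lborel Y (exponential_density 1)"
  shows "AE w in Q. 0 \<le> Y w"
proof -
  interpret prob_space Q by fact
  have Y_meas[measurable]: "Y \<in> borel_measurable Q" using Y by (auto simp: distributed_def)
  have "\<P>(w in Q. 0 < Y w) = 1" using exponential_distributedD_gt[OF Y, of 0] by simp
  then have "AE w in Q. w \<in> {w \<in> space Q. 0 < Y w}"
    by (subst AE_in_set_eq_1) auto
  then show ?thesis by eventually_elim auto
qed

lemma exponential_laplace:
  assumes Q: "prob_space Q" and Y: "distributed Q lborel Y (exponential_density 1)" and a: "0 \<le> a"
  shows "(\<integral>w. exp (- a * Y w) \<partial>Q) = 1 / (1 + a)"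
proof -
  interpret prob_space Q by fact
  have Y_meas[measurable]: "Y \<in> borel_measurable Q" using Y by (auto simp: distributed_def)
  interpret E: prob_space "density lborel (exponential_density (1 + a))"
    using a by (intro prob_space_exponential_density) simp
  have "(\<integral>x. exponential_density (1 + a) x \<partial>lborel) = (\<integral>x. 1 \<partial>density lborel (exponential_density (1 + a)))"
    using a by (subst integral_density) (auto intro!: AE_I2 exponential_density_nonneg)
  then have tot: "(\<integral>x. exponential_density (1 + a) x \<partial>lborel) = 1"
    using E.prob_space by simp
  have "(\<integral>w. exp (- a * Y w) \<partial>Q) = (\<integral>x. exponential_density 1 x * exp (- a * x) \<partial>lborel)"
    by (rule distributed_integral[OF Y, symmetric]) (auto intro: exponential_density_nonneg)
  also have "\<dots> = (\<integral>x. (1 / (1 + a)) * exponential_density (1 + a) x \<partial>lborel)"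
  proof (intro Bochner_Integration.integral_cong refl)
    fix x
    have "exp (- x) * exp (- a * x) = exp (- x * (1 + a))"
      by (simp add: mult_exp_exp algebra_simps)
    then show "exponential_density 1 x * exp (- a * x) = (1 / (1 + a)) * exponential_density (1 + a) x"
      using a by (simp add: exponential_density_def)
  qed
  also have "\<dots> = 1 / (1 + a)" using tot by simp
  finally show ?thesis .
qed

lemma geometric_generating:
  assumes p: "0 < p" "p < 1" and b: "0 \<le> b" "b \<le> 1"
  shows "(\<lambda>m. pmf (map_pmf (\<lambda>n. n + d) (Geo p)) m * b ^ m) sums (b ^ d * (1 - p) / (1 - p * b))"
proof -
  have "p * b < 1" using p b mult_left_le[of b p] by linarith
  then have "(\<lambda>n. (p * b) ^ n) sums (1 / (1 - p * b))"
    using p b by (intro geometric_sums) simp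
  from sums_mult[OF this, of "b ^ d * (1 - p)"]
  have "(\<lambda>n. pmf (map_pmf (\<lambda>n. n + d) (Geo p)) (n + d) * b ^ (n + d)) sums (b ^ d * (1 - p) / (1 - p * b))"
    using p pmf_map_inj'[of "\<lambda>n. n + d" "Geo p"]
    by (simp add: pmf_Geo inj_on_def power_mult_distrib power_add mult_ac)
  moreover have "pmf (map_pmf (\<lambda>n. n + d) (Geo p)) m = 0" if "m < d" for m
    using that by (intro pmf_map_outside) auto
  ultimately show ?thesis
    by (subst (asm) sums_zero_iff_shift) simp_all
qed

lemma geometric_mean:
  assumes p: "0 < p" "p < 1"
  shows "measure_pmf.expectation (map_pmf (\<lambda>n. n + d) (Geo p)) real = p / (1 - p) + real d"
proof -
  have "measure_pmf.expectation (map_pmf (\<lambda>n. n + d) (Geo p)) real =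
      measure_pmf.expectation (Geo p) (\<lambda>n. real n + real d)"
    by simp
  also have "\<dots> = measure_pmf.expectation (Geo p) real + real d"
    unfolding Geo_def using p
    by (subst Bochner_Integration.integral_add) (auto intro!: integrable_real_geometric_pmf)
  also have "\<dots> = p / (1 - p) + real d"
    unfolding Geo_def using p by (subst expectation_geometric_pmf) auto
  finally show ?thesis .
qed

text \<open>
  Given \<open>M = m\<close>, the sum consists of \<open>m\<close> independent exponential variables, each with transform
  \<open>1 / (1 + a)\<close>. The indicator of \<open>M = m\<close> is treated as the factor of index \<open>0\<close> of an independent
  family.
\<close>

lemma random_sum_laplace:
  fixes M :: "'v \<Rightarrow> nat" and Y :: "nat \<Rightarrow> 'v \<Rightarrow> real"
  assumes Q: "prob_space Q" and M: "M \<in> Q \<rightarrow>\<^sub>M count_space UNIV"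
    and law: "distr Q (count_space UNIV) M = measure_pmf D"
    and Y: "\<And>i. i \<ge> 1 \<Longrightarrow> distributed Q lborel (Y i) (exponential_density 1)"
    and indep: "prob_space.indep_vars Q (\<lambda>i. borel) (\<lambda>i w. if i = 0 then real (M w) else Y i w) (UNIV :: nat set)"
    and a: "0 \<le> a"
  shows "(\<lambda>m. pmf D m * (1 / (1 + a)) ^ m) sums (\<integral>w. exp (- a * (\<Sum>i=1..M w. Y i w)) \<partial>Q)"
proof -
  interpret prob_space Q by fact
  have Y_meas[measurable]: "Y i \<in> borel_measurable Q" if "i \<ge> 1" for i
    using Y[OF that] by (auto simp: distributed_def)
  note M[measurable]
  have Y_pos: "AE w in Q. \<forall>i\<in>{1..}. 0 \<le> Y i w"
    using exponential_nonneg[OF Q Y] by (subst AE_ball_countable) auto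
  have PM: "(\<integral>w. indicator {real m} (real (M w)) \<partial>Q) = pmf D m" for m
  proof -
    have "(\<integral>w. indicator {real m} (real (M w)) \<partial>Q) = (\<integral>w. indicator (M -` {m} \<inter> space Q) w \<partial>Q)"
      by (intro Bochner_Integration.integral_cong) (auto simp: indicator_def)
    also have "\<dots> = measure Q (M -` {m} \<inter> space Q)"
      by (simp add: measurable_sets[OF M])
    also have "\<dots> = measure (distr Q (count_space UNIV) M) {m}"
      by (rule measure_distr[OF M, symmetric]) simp
    finally show ?thesis by (simp add: law pmf.rep_eq)
  qed
  define H where "H m w = indicator {real m} (real (M w)) * exp (- a * (\<Sum>i=1..m. Y i w))" for m w
  have H_meas[measurable]: "H m \<in> borel_measurable Q" for m
  proof -
    have "(\<lambda>w. \<Sum>i=1..m. Y i w) \<in> borel_measurable Q" by (intro borel_measurable_sum Y_meas) auto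
    then show ?thesis unfolding H_def[abs_def] by measurable
  qed
  have H_exp: "(\<integral>w. H m w \<partial>Q) = pmf D m * (1 / (1 + a)) ^ m" for m
  proof -
    define g where "g i = (if i = 0 then indicator {real m} else (\<lambda>x. exp (- a * x)))" for i :: nat
    define Z where "Z i w = g i (if i = 0 then real (M w) else Y i w)" for i w
    have g_meas: "g i \<in> borel_measurable borel" for i by (simp add: g_def)
    have "indep_vars (\<lambda>_. borel) Z {..m}"
      unfolding Z_def
      by (rule indep_vars_compose2[OF indep_vars_subset[OF indep] g_meas]) auto
    moreover have "integrable Q (Z i)" for i
    proof (rule integrable_const_bound[of _ 1])
      show "AE w in Q. norm (Z i w) \<le> 1"
        using Y_pos
      proof eventually_elim
        case (elim w)
        then have "0 \<le> a * Y i w" if "i \<noteq> 0" using a that by auto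
        then show ?case by (auto simp: Z_def g_def indicator_def)
      qed
      show "Z i \<in> borel_measurable Q"
        by (cases "i = 0") (auto simp: Z_def[abs_def] g_def)
    qed
    ultimately have "(\<integral>w. (\<Prod>i\<in>{..m}. Z i w) \<partial>Q) = (\<Prod>i\<in>{..m}. \<integral>w. Z i w \<partial>Q)"
      by (intro indep_vars_lebesgue_integral) auto
    moreover have "(\<Prod>i\<in>{..m}. Z i w) = H m w" for w
      unfolding atMost_atLeast0 by (subst prod.atLeast_Suc_atMost)
        (auto simp: Z_def g_def H_def sum_distrib_left exp_sum[symmetric] intro!: prod.cong)
    moreover have "(\<Prod>i\<in>{..m}. \<integral>w. Z i w \<partial>Q) = pmf D m * (1 / (1 + a)) ^ m"
    proof -
      have "(\<Prod>i\<in>{..m}. \<integral>w. Z i w \<partial>Q) = (\<integral>w. Z 0 w \<partial>Q) * (\<Prod>i\<in>{1..m}. \<integral>w. Z i w \<partial>Q)"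
        unfolding atMost_atLeast0 by (subst prod.atLeast_Suc_atMost) auto
      also have "(\<Prod>i\<in>{1..m}. \<integral>w. Z i w \<partial>Q) = (\<Prod>i\<in>{1..m}. 1 / (1 + a))"
        using exponential_laplace[OF Q Y a] by (intro prod.cong) (auto simp: Z_def g_def)
      also have "(\<integral>w. Z 0 w \<partial>Q) = pmf D m" using PM by (simp add: Z_def g_def)
      finally show ?thesis by simp
    qed
    ultimately show ?thesis by simp
  qed
  have H_bound: "AE w in Q. \<forall>m. 0 \<le> H m w \<and> H m w \<le> indicator {real m} (real (M w))"
    using Y_pos
  proof eventually_elim
    case (elim w)
    have "0 \<le> a * (\<Sum>i=1..m. Y i w)" for m using a elim by (intro mult_nonneg_nonneg sum_nonneg) auto
    then show ?case by (auto simp: H_def indicator_def)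
  qed
  have H_int: "integrable Q (H m)" for m
  proof (rule integrable_const_bound[of _ 1])
    show "AE w in Q. norm (H m w) \<le> 1"
      using H_bound
    proof eventually_elim
      case (elim w)
      then have le: "0 \<le> H m w" "H m w \<le> indicator {real m} (real (M w))" by blast+
      have "H m w \<le> 1" by (rule order_trans[OF le(2) indicator_le_1])
      then show ?case using le(1) by simp
    qed
  qed (rule H_meas)
  have H_sum: "(\<lambda>m. H m w) sums exp (- a * (\<Sum>i=1..M w. Y i w))" for w
  proof -
    have "(\<lambda>m. H m w) = (\<lambda>m. if m = M w then exp (- a * (\<Sum>i=1..M w. Y i w)) else 0)"
      by (auto simp: H_def indicator_def)
    then show ?thesis using sums_single[of "M w" "\<lambda>_. exp (- a * (\<Sum>i=1..M w. Y i w))"] by simp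
  qed
  have H_abs: "(\<integral>w. norm (H m w) \<partial>Q) = pmf D m * (1 / (1 + a)) ^ m" for m
    unfolding H_exp[symmetric] by (rule integral_cong_AE) (use H_bound in \<open>auto elim!: eventually_mono\<close>)
  have "(\<lambda>m. \<integral>w. H m w \<partial>Q) sums (\<integral>w. (\<Sum>m. H m w) \<partial>Q)"
  proof (rule sums_integral[OF H_int])
    show "AE w in Q. summable (\<lambda>m. norm (H m w))"
      using H_bound
    proof eventually_elim
      case (elim w)
      then have "(\<lambda>m. norm (H m w)) = (\<lambda>m. H m w)" by auto
      then show ?case using sums_summable[OF H_sum] by simp
    qed
    have "summable (pmf D)"
      using integrable_pmf[of UNIV D] by (simp add: integrable_count_space_nat_iff)
    then show "summable (\<lambda>m. \<integral>w. norm (H m w) \<partial>Q)"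
      unfolding H_abs
      by (rule summable_comparison_test'[where N = 0])
         (use a in \<open>auto simp: abs_mult intro!: mult_left_le power_le_one\<close>)
  qed
  then show ?thesis using H_sum by (simp add: H_exp sums_iff)
qed

section \<open>Weak convergence from Laplace transforms at the natural numbers\<close>

text \<open>
  In the variable \<open>u = exp(-x)\<close> the hypothesis concerns moments of laws on \<open>[0,1]\<close>. By the Weierstrass
  theorem it extends from monomials to continuous functions of \<open>u\<close>, among them the transported ramp
  functions \<^const>\<open>cts_step\<close>, and these determine weak convergence.
\<close>

lemma laplace_imp_weak_conv:
  fixes \<mu> :: "real \<Rightarrow> real measure"
  assumes \<mu>: "\<And>i. 0 < i \<Longrightarrow> real_distribution (\<mu> i)" and \<mu>0: "real_distribution \<mu>\<^sub>0"
    and nonneg: "\<And>i. 0 < i \<Longrightarrow> AE x in \<mu> i. 0 \<le> x" and nonneg0: "AE x in \<mu>\<^sub>0. 0 \<le> x"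
    and conv: "\<And>n::nat. ((\<lambda>i. \<integral>x. exp (- real n * x) \<partial>\<mu> i) \<longlongrightarrow> (\<integral>x. exp (- real n * x) \<partial>\<mu>\<^sub>0)) at_top"
  shows "weak_conv_filter \<mu> \<mu>\<^sub>0 at_top"
proof -
  have step: "((\<lambda>i. \<integral>x. cts_step a b x \<partial>\<mu> i) \<longlongrightarrow> (\<integral>x. cts_step a b x \<partial>\<mu>\<^sub>0)) at_top"
    if ab: "a < b" for a b
  proof -
    \<comment> \<open>A ramp vanishes for large \<open>x\<close>, so it extends continuously by \<open>0\<close> to \<open>u = 0\<close>.\<close>
    define h where "h u = (if u \<le> 0 then 0 else cts_step a b (- ln u))" for u
    have "continuous_on ({..<exp (- b)} \<union> {0<..}) h"
    proof (rule continuous_on_open_Un)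
      have "continuous_on {..<exp (- b)} (\<lambda>_. 0 :: real)" by simp
      moreover have "h u = 0" if u: "u \<in> {..<exp (- b)}" for u
      proof (cases "u \<le> 0")
        case False
        then have "ln u < ln (exp (- b))" using u by (subst ln_less_cancel_iff) auto
        then show ?thesis using False ab by (simp add: h_def cts_step_def)
      qed (simp add: h_def)
      ultimately show "continuous_on {..<exp (- b)} h"
        using continuous_on_cong[OF refl, of "{..<exp (- b)}" h "\<lambda>_. 0"] by simp
      have "continuous_on {0<..} (cts_step a b \<circ> (\<lambda>u. - ln u))"
        using uniformly_continuous_imp_continuous[OF cts_step_uniformly_continuous[OF ab]]
        by (intro continuous_on_compose continuous_intros) (auto intro: continuous_on_subset)
      then show "continuous_on {0<..} h" by (subst continuous_on_cong[OF refl]) (auto simp: h_def)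
    qed auto
    moreover have "u < exp (- b) \<or> 0 < u" for u using exp_gt_zero[of "- b"] by linarith
    then have "({..<exp (- b)} \<union> {0<..}) = UNIV" by auto
    ultimately have h_cont: "continuous_on {0..1} h" by (metis continuous_on_subset subset_UNIV)
    have h_exp: "h (exp (- x)) = cts_step a b x" for x by (simp add: h_def)
    show ?thesis
    proof (rule tendstoI)
      fix e :: real assume e: "0 < e"
      have triangle: "\<bar>u - v\<bar> < e"
        if "\<bar>u' - v'\<bar> < e / 3" "\<bar>u - u'\<bar> \<le> e / 3" "\<bar>v - v'\<bar> \<le> e / 3" for u v u' v' :: real
        using that by (simp add: abs_if split: if_splits)
      obtain P where P: "real_polynomial_function P" "\<And>u. u \<in> {0..1} \<Longrightarrow> \<bar>h u - P u\<bar> < e / 3"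
        using Stone_Weierstrass_real_polynomial_function[OF compact_Icc h_cont, of "e / 3"] e by auto
      then obtain c n where c: "P = (\<lambda>u. \<Sum>i\<le>n. c i * u ^ i)"
        using real_polynomial_function_iff_sum by auto
      have P_exp: "P (exp (- x)) = (\<Sum>i\<le>n. c i * exp (- real i * x))" for x
        unfolding c by (simp add: exp_of_nat_mult[symmetric])
      have exp_int: "integrable N (\<lambda>x. exp (- real i * x))"
        if "real_distribution N" "AE x in N. 0 \<le> x" for N i
      proof -
        interpret real_distribution N by fact
        show ?thesis
          by (rule integrable_const_bound[of _ 1]) (use that(2) in \<open>auto elim!: eventually_mono\<close>)
      qed
      have approx: "\<bar>(\<integral>x. cts_step a b x \<partial>N) - (\<Sum>i\<le>n. c i * (\<integral>x. exp (- real i * x) \<partial>N))\<bar> \<le> e / 3"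
        if N: "real_distribution N" "AE x in N. 0 \<le> x" for N
      proof -
        interpret real_distribution N by fact
        have int_P: "integrable N (\<lambda>x. P (exp (- x)))"
          unfolding P_exp by (intro Bochner_Integration.integrable_sum integrable_mult_right exp_int N)
        have "(\<Sum>i\<le>n. c i * (\<integral>x. exp (- real i * x) \<partial>N)) = (\<integral>x. P (exp (- x)) \<partial>N)"
          unfolding P_exp using exp_int[OF N] by (subst Bochner_Integration.integral_sum) auto
        then have "\<bar>(\<integral>x. cts_step a b x \<partial>N) - (\<Sum>i\<le>n. c i * (\<integral>x. exp (- real i * x) \<partial>N))\<bar> =
            \<bar>\<integral>x. cts_step a b x - P (exp (- x)) \<partial>N\<bar>"
          using int_P integrable_cts_step[OF ab] by simp
        also have "\<dots> \<le> (\<integral>x. \<bar>cts_step a b x - P (exp (- x))\<bar> \<partial>N)" by (rule integral_abs_bound)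
        also have "\<dots> \<le> (\<integral>x. e / 3 \<partial>N)"
        proof (rule integral_mono_AE)
          show "AE x in N. \<bar>cts_step a b x - P (exp (- x))\<bar> \<le> e / 3"
            using N(2)
          proof eventually_elim
            case (elim x)
            then show ?case using P(2)[of "exp (- x)"] by (simp add: h_exp)
          qed
        qed (use int_P integrable_cts_step[OF ab] in auto)
        finally show ?thesis using prob_space by simp
      qed
      have "((\<lambda>i. \<Sum>j\<le>n. c j * (\<integral>x. exp (- real j * x) \<partial>\<mu> i)) \<longlongrightarrow>
          (\<Sum>j\<le>n. c j * (\<integral>x. exp (- real j * x) \<partial>\<mu>\<^sub>0))) at_top"
        by (intro tendsto_intros conv)
      then have "eventually (\<lambda>i. dist (\<Sum>j\<le>n. c j * (\<integral>x. exp (- real j * x) \<partial>\<mu> i))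
          (\<Sum>j\<le>n. c j * (\<integral>x. exp (- real j * x) \<partial>\<mu>\<^sub>0)) < e / 3) at_top"
        using e by (intro tendstoD) auto
      then show "eventually (\<lambda>i. dist (\<integral>x. cts_step a b x \<partial>\<mu> i) (\<integral>x. cts_step a b x \<partial>\<mu>\<^sub>0) < e) at_top"
        using eventually_gt_at_top[of "0::real"]
      proof eventually_elim
        case (elim i)
        show ?case
          unfolding dist_real_def
          by (rule triangle[OF _ approx[OF \<mu> nonneg] approx[OF \<mu>0 nonneg0]])
             (use elim in \<open>simp_all only: dist_real_def\<close>)
      qed
    qed
  qed
  show ?thesis
    unfolding weak_conv_filter_def
  proof (intro allI impI tendsto_at_topI_sequentially)
    fix x and s :: "nat \<Rightarrow> real" assume x: "isCont (cdf \<mu>\<^sub>0) x" and s: "filterlim s at_top sequentially"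
    \<comment> \<open>A sequence tending to infinity may start with nonpositive indices, for which \<open>\<mu>\<close> need not be a
        distribution.\<close>
    define N where "N n = (if 0 < s n then \<mu> (s n) else \<mu>\<^sub>0)" for n
    have ev: "eventually (\<lambda>n. N n = \<mu> (s n)) sequentially"
      using s by (auto simp: N_def filterlim_at_top_dense elim!: eventually_mono)
    have "weak_conv_m N \<mu>\<^sub>0"
    proof (rule integral_cts_step_conv_imp_weak_conv)
      show "real_distribution (N n)" for n using \<mu> \<mu>0 by (simp add: N_def)
      fix a b :: real assume "a < b"
      from filterlim_compose[OF step[OF this] s]
      show "(\<lambda>n. \<integral>x. cts_step a b x \<partial>N n) \<longlonglongrightarrow> (\<integral>x. cts_step a b x \<partial>\<mu>\<^sub>0)"
        by (rule Lim_transform_eventually) (use ev in \<open>auto elim!: eventually_mono\<close>)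
    qed (rule \<mu>0)
    then have "(\<lambda>n. cdf (N n) x) \<longlonglongrightarrow> cdf \<mu>\<^sub>0 x"
      using x by (auto simp: weak_conv_m_def weak_conv_def)
    then show "(\<lambda>n. cdf (\<mu> (s n)) x) \<longlonglongrightarrow> cdf \<mu>\<^sub>0 x"
      by (rule Lim_transform_eventually) (use ev in \<open>auto elim!: eventually_mono\<close>)
  qed
qed

section \<open>Convergence of the scaled passage time\<close>

text \<open>
  The real-valued scaled time and \<^const>\<open>exp_decay\<close> disagree where \<open>T = \<infinity>\<close>, which is a null set because
  the mean is finite.
\<close>

lemma transform_scaled_passage:
  assumes P: "prob_space P" and T[measurable]: "T \<in> borel_measurable P"
    and m: "0 < m" and mean: "(\<integral>\<^sup>+w. T w \<partial>P) = ennreal m"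
  shows "(\<integral>w. exp (- \<theta> * enn2real (T w / ennreal m)) \<partial>P) = (\<integral>w. exp_decay (\<theta> / m) (T w) \<partial>P)"
proof (rule integral_cong_AE)
  have "AE w in P. T w \<noteq> \<infinity>" by (rule nn_integral_PInf_AE[OF T]) (simp add: mean)
  then show "AE w in P. exp (- \<theta> * enn2real (T w / ennreal m)) = exp_decay (\<theta> / m) (T w)"
  proof eventually_elim
    case (elim w)
    then have "T w = ennreal (enn2real (T w))" by (simp add: less_top)
    then have "T w / ennreal m = ennreal (enn2real (T w) / m)"
      using m by (metis divide_ennreal enn2real_nonneg)
    then show ?case using elim m by (simp add: exp_decay_def)
  qed
qed measurable

lemma random_sum_measurable:
  fixes M :: "'v \<Rightarrow> nat" and Y :: "nat \<Rightarrow> 'v \<Rightarrow> real"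
  assumes M: "M \<in> Q \<rightarrow>\<^sub>M count_space UNIV" and Y: "\<And>i. i \<ge> 1 \<Longrightarrow> Y i \<in> borel_measurable Q"
  shows "(\<lambda>w. \<Sum>i=1..M w. Y i w) \<in> borel_measurable Q"
  by (rule measurable_compose_countable[OF _ M, of "\<lambda>m w. \<Sum>i=1..m. Y i w"])
     (intro borel_measurable_sum Y, simp)

theorem mainTheorem4:
  fixes K :: nat and L :: "nat \<Rightarrow> nat" and k\<^sub>1 k\<^sub>2 l\<^sub>1 l\<^sub>2 :: nat
    and P :: "real \<Rightarrow> 'w measure" and X :: "real \<Rightarrow> real \<Rightarrow> 'w \<Rightarrow> state"
    and Q :: "'v measure" and M :: "'v \<Rightarrow> nat" and Y :: "nat \<Rightarrow> 'v \<Rightarrow> real"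
  defines "T \<equiv> \<lambda>\<nu>. first_passage_time (X \<nu>) (Active k\<^sub>2 l\<^sub>2)"
  assumes "K \<ge> 2" and "\<forall>k\<in>{1..K}. L k \<ge> 1"
    and "k\<^sub>1 \<in> {1..K}" and "k\<^sub>2 \<in> {1..K}" and "k\<^sub>1 \<noteq> k\<^sub>2"
    and "0 < l\<^sub>1" and "l\<^sub>1 \<le> L k\<^sub>1" and "0 < l\<^sub>2" and "l\<^sub>2 \<le> L k\<^sub>2"
    and "\<And>\<nu>. \<nu> > 0 \<Longrightarrow> markov_process (P \<nu>) (Omega K L) (rate L \<nu>) (Active k\<^sub>1 l\<^sub>1) (X \<nu>)"
    and "prob_space Q"
    and "M \<in> Q \<rightarrow>\<^sub>M count_space UNIV"
    and "distr Q (count_space UNIV) M =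
           measure_pmf (map_pmf (\<lambda>n. n + (if k\<^sub>1 \<in> K_star K L k\<^sub>2 then 1 else 0))
                                (Geo (p_star K L k\<^sub>2)))"
    and "\<And>i. i \<ge> 1 \<Longrightarrow> distributed Q lborel (Y i) (exponential_density 1)"
    and "prob_space.indep_vars Q (\<lambda>i. borel) (\<lambda>i w. if i = 0 then real (M w) else Y i w) (UNIV :: nat set)"
  shows "weak_conv_filter
           (\<lambda>\<nu>. distr (P \<nu>) borel (\<lambda>w. enn2real (T \<nu> w / (\<integral>\<^sup>+ w'. T \<nu> w' \<partial>P \<nu>))))
           (distr Q borel (\<lambda>w. 1 / prob_space.expectation Q (\<lambda>w'. real (M w')) * (\<Sum>i=1..M w. Y i w)))
           at_top"
proof -
  note L = assms(3) and k = assms(4-6) and l = assms(7-10) and mp = assms(11) and Q = assms(12)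
    and M = assms(13) and law = assms(14) and Y = assms(15) and indep = assms(16)
  interpret Q: prob_space Q by fact

  define N where "N = L_star K L k\<^sub>2"
  define n where "n = real (L k\<^sub>2)"
  define \<kappa> where "\<kappa> = real (card (K_star K L k\<^sub>2))"
  define d where "d = (if k\<^sub>1 \<in> K_star K L k\<^sub>2 then 1 else 0 :: nat)"
  define p where "p = p_star K L k\<^sub>2"
  have k1: "k\<^sub>1 \<in> {1..K} - {k\<^sub>2}" using k by simp
  have "L k\<^sub>1 \<le> N" unfolding N_def L_star_def using k1 by (intro Max_ge) auto
  then have "1 \<le> N" using L k by force
  then obtain R where R: "N = Suc R" by (cases N) auto
  have "N \<in> L ` ({1..K} - {k\<^sub>2})" unfolding N_def L_star_def using k1 by (intro Max_in) auto
  then have "K_star K L k\<^sub>2 \<noteq> {}" by (auto simp: K_star_def N_def)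
  moreover have "finite (K_star K L k\<^sub>2)" by (simp add: K_star_def)
  ultimately have \<kappa>: "1 \<le> \<kappa>" by (simp add: \<kappa>_def card_gt_0_iff Suc_le_eq)
  have n: "0 < n" using l by (simp add: n_def)
  have N0: "0 < real N" using R by simp
  have p_eq: "p = \<kappa> * real N / (\<kappa> * real N + n)"
    by (simp add: p_def p_star_def \<kappa>_def N_def n_def)
  have \<kappa>N: "0 < \<kappa> * real N" using \<kappa> N0 by simp
  have p: "0 < p" "p < 1" using \<kappa>N n by (auto simp: p_eq)
  have odds: "p / (1 - p) = \<kappa> * real N / n"
  proof -
    have "1 - p = n / (\<kappa> * real N + n)"
      unfolding p_eq using \<kappa>N n by (simp add: diff_divide_eq_iff)
    then show ?thesis unfolding p_eq using \<kappa>N n by simp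
  qed
  \<comment> \<open>The limit of \<open>E T / \<nu>^(N - 1)\<close>; the value of \<open>e\<close> below is \<open>E M\<close>, and the
      ratio \<open>c / e = 1 / N\<close> is the mean of a single rescaled excursion.\<close>
  define c where "c = \<kappa> / n + real d / real N"
  have c: "0 < c" using \<kappa> n by (auto simp: c_def intro!: add_pos_nonneg)
  define e where "e = real N * c"
  have e: "0 < e" using c N0 by (simp add: e_def)

  have law': "distr Q (count_space UNIV) M = measure_pmf (map_pmf (\<lambda>n. n + d) (Geo p))"
    using law by (simp add: d_def p_def)
  have "Q.expectation (\<lambda>w. real (M w)) = (\<integral>m. real m \<partial>distr Q (count_space UNIV) M)"
    by (rule integral_distr[OF M, symmetric]) simp
  also have "\<dots> = p / (1 - p) + real d" unfolding law' by (rule geometric_mean[OF p])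
  also have "\<dots> = e" using N0 n by (simp add: odds e_def c_def field_simps)
  finally have EM: "Q.expectation (\<lambda>w. real (M w)) = e" .

  define m where "m \<nu> = passage_functional K L \<nu> k\<^sub>1 l\<^sub>1 k\<^sub>2 l\<^sub>2 (\<lambda>_. 1)" for \<nu>
  have m_pos: "0 < m \<nu>" if "0 < \<nu>" for \<nu>
    unfolding m_def by (rule passage_functional_pos) (use that l in auto)
  have mean: "(\<integral>\<^sup>+w. T \<nu> w \<partial>P \<nu>) = ennreal (m \<nu>)" if "0 < \<nu>" for \<nu>
    unfolding T_def m_def by (rule mean_passage_time[OF mp[OF that] that L k l])
  have m_lim: "((\<lambda>\<nu>. m \<nu> / \<nu> ^ R) \<longlongrightarrow> c) at_top"
  proof -
    have "real d / real N = (if k\<^sub>1 \<in> K_star K L k\<^sub>2 then 1 / real (Suc R) else 0)"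
      by (simp add: d_def R)
    then show ?thesis
      unfolding m_def c_def \<kappa>_def n_def using mean_limit[OF k l R[unfolded N_def]] by (simp only:)
  qed

  have P: "prob_space (P \<nu>)" if "0 < \<nu>" for \<nu> using mp[OF that] by (simp add: markov_process_def)
  have T_meas: "T \<nu> \<in> borel_measurable (P \<nu>)" if "0 < \<nu>" for \<nu>
    unfolding T_def using mp[OF that] k l
    by (intro first_passage_time_measurable[where S = "Omega K L"]) (auto simp: markov_process_def Omega_def)
  have V_meas: "(\<lambda>w. enn2real (T \<nu> w / (\<integral>\<^sup>+ w'. T \<nu> w' \<partial>P \<nu>))) \<in> borel_measurable (P \<nu>)" if "0 < \<nu>" for \<nu>
    using T_meas[OF that] by measurable
  have Y_meas: "Y i \<in> borel_measurable Q" if "i \<ge> 1" for i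
    using Y[OF that] by (auto simp: distributed_def)
  have Z_meas: "(\<lambda>w. 1 / e * (\<Sum>i=1..M w. Y i w)) \<in> borel_measurable Q"
    using random_sum_measurable[OF M Y_meas] by measurable

  show ?thesis
    unfolding EM
  proof (rule laplace_imp_weak_conv)
    show "real_distribution (distr (P \<nu>) borel (\<lambda>w. enn2real (T \<nu> w / (\<integral>\<^sup>+ w'. T \<nu> w' \<partial>P \<nu>))))" if "0 < \<nu>" for \<nu>
      by (rule prob_space.real_distribution_distr[OF P[OF that] V_meas[OF that]])
    show "real_distribution (distr Q borel (\<lambda>w. 1 / e * (\<Sum>i=1..M w. Y i w)))"
      by (rule Q.real_distribution_distr[OF Z_meas])
    show "AE x in distr (P \<nu>) borel (\<lambda>w. enn2real (T \<nu> w / (\<integral>\<^sup>+ w'. T \<nu> w' \<partial>P \<nu>))). 0 \<le> x" if "0 < \<nu>" for \<nu>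
      using V_meas[OF that] by (subst AE_distr_iff) auto
    have "AE w in Q. \<forall>i\<in>{1..}. 0 \<le> Y i w"
      using exponential_nonneg[OF Q Y] by (subst AE_ball_countable) auto
    then have "AE w in Q. 0 \<le> 1 / e * (\<Sum>i=1..M w. Y i w)"
      by eventually_elim (use e in \<open>auto intro!: sum_nonneg divide_nonneg_pos\<close>)
    then show "AE x in distr Q borel (\<lambda>w. 1 / e * (\<Sum>i=1..M w. Y i w)). 0 \<le> x"
      using Z_meas by (subst AE_distr_iff) auto
    fix j :: nat
    let ?V = "\<lambda>\<nu> w. enn2real (T \<nu> w / (\<integral>\<^sup>+ w'. T \<nu> w' \<partial>P \<nu>))"
    let ?Z = "\<lambda>w. 1 / e * (\<Sum>i=1..M w. Y i w)"
    show "((\<lambda>\<nu>. \<integral>x. exp (- real j * x) \<partial>distr (P \<nu>) borel (?V \<nu>)) \<longlongrightarrow>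
        (\<integral>x. exp (- real j * x) \<partial>distr Q borel ?Z)) at_top"
    proof (cases "j = 0")
      case True
      have "eventually (\<lambda>\<nu>. (\<integral>x. exp (- real j * x) \<partial>distr (P \<nu>) borel (?V \<nu>)) = 1) at_top"
        using eventually_gt_at_top[of 0]
      proof eventually_elim
        case (elim \<nu>)
        show ?case
          using prob_space.prob_space[OF P[OF elim]] by (subst integral_distr[OF V_meas[OF elim]]) (auto simp: True)
      qed
      moreover have "(\<integral>x. exp (- real j * x) \<partial>distr Q borel ?Z) = 1"
        using Q.prob_space by (subst integral_distr[OF Z_meas]) (auto simp: True)
      ultimately show ?thesis by (simp add: tendsto_eventually)
    next
      case False
      then have j: "0 < real j" by simp
      \<comment> \<open>The two sides are compared at the argument \<open>a\<close> of the unit exponentials; on the side of the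
          passage time it reappears as \<open>\<sigma> / N\<close>.\<close>
      define a where "a = real j / e"
      have a: "0 < a" using j e by (simp add: a_def)
      define s where "s \<nu> = real j / m \<nu>" for \<nu>
      have "\<exists>f. 0 < \<nu> \<longrightarrow> passage_transform K L \<nu> k\<^sub>2 l\<^sub>2 (s \<nu>) f \<and>
          along f k\<^sub>1 l\<^sub>1 = (\<integral>w. exp_decay (s \<nu>) (T \<nu> w) \<partial>P \<nu>)" for \<nu>
        unfolding T_def s_def using passage_transform_exists[OF mp _ _ L k l, of \<nu> "real j / m \<nu>"] j m_pos by auto
      then obtain f where f: "\<And>\<nu>. 0 < \<nu> \<Longrightarrow> passage_transform K L \<nu> k\<^sub>2 l\<^sub>2 (s \<nu>) (f \<nu>)"
        and f_start: "\<And>\<nu>. 0 < \<nu> \<Longrightarrow> along (f \<nu>) k\<^sub>1 l\<^sub>1 = (\<integral>w. exp_decay (s \<nu>) (T \<nu> w) \<partial>P \<nu>)"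
        by metis
      define \<sigma> where "\<sigma> = real j / c"
      have s_lim: "((\<lambda>\<nu>. s \<nu> * \<nu> ^ R) \<longlongrightarrow> \<sigma>) at_top"
      proof -
        have "((\<lambda>\<nu>. real j / (m \<nu> / \<nu> ^ R)) \<longlongrightarrow> \<sigma>) at_top"
          unfolding \<sigma>_def using c by (intro tendsto_divide tendsto_const m_lim) auto
        then show ?thesis by (simp add: s_def)
      qed
      define lim where "lim = 1 / (1 + \<sigma> * \<kappa> / (n * (1 + \<sigma> / real N))) *
        (if k\<^sub>1 \<in> K_star K L k\<^sub>2 then 1 / (1 + \<sigma> / real N) else 1)"
      have \<sigma>: "0 \<le> \<sigma>" using j c by (simp add: \<sigma>_def)
      have f_lim: "((\<lambda>\<nu>. along (f \<nu>) k\<^sub>1 l\<^sub>1) \<longlongrightarrow> lim) at_top"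
        using transform_limit[OF k l R[unfolded N_def] f s_lim \<sigma>]
        unfolding lim_def \<kappa>_def n_def R .
      have "eventually (\<lambda>\<nu>. along (f \<nu>) k\<^sub>1 l\<^sub>1 = (\<integral>x. exp (- real j * x) \<partial>distr (P \<nu>) borel (?V \<nu>))) at_top"
        using eventually_gt_at_top[of 0]
      proof eventually_elim
        case (elim \<nu>)
        have "(\<integral>x. exp (- real j * x) \<partial>distr (P \<nu>) borel (?V \<nu>)) = (\<integral>w. exp (- real j * ?V \<nu> w) \<partial>P \<nu>)"
          by (rule integral_distr[OF V_meas[OF elim]]) measurable
        also have "\<dots> = (\<integral>w. exp_decay (s \<nu>) (T \<nu> w) \<partial>P \<nu>)"
          unfolding mean[OF elim] s_def
          by (rule transform_scaled_passage[OF P[OF elim] T_meas[OF elim] m_pos[OF elim] mean[OF elim]])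
        finally show ?case using f_start[OF elim] by simp
      qed
      with f_lim have conv: "((\<lambda>\<nu>. \<integral>x. exp (- real j * x) \<partial>distr (P \<nu>) borel (?V \<nu>)) \<longlongrightarrow> lim) at_top"
        by (rule Lim_transform_eventually)
      define b where "b = 1 / (1 + a)"
      have b: "0 \<le> b" "b \<le> 1" using a by (auto simp: b_def)
      have "(\<integral>x. exp (- real j * x) \<partial>distr Q borel ?Z) = (\<integral>w. exp (- a * (\<Sum>i=1..M w. Y i w)) \<partial>Q)"
        by (subst integral_distr[OF Z_meas]) (auto simp: a_def)
      also have "\<dots> = b ^ d * (1 - p) / (1 - p * b)"
        using random_sum_laplace[OF Q M law' Y indep less_imp_le[OF a]] geometric_generating[OF p b, of d]
        unfolding b_def[symmetric] by (rule sums_unique2)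
      also have "\<dots> = lim"
      proof -
        have \<sigma>a: "\<sigma> / real N = a" using c by (simp add: \<sigma>_def a_def e_def)
        have "\<sigma> * \<kappa> / (n * (1 + \<sigma> / real N)) = (\<sigma> / real N) * (\<kappa> * real N / n) / (1 + \<sigma> / real N)"
          using N0 n a by (simp add: divide_simps)
        also have "\<dots> = a * (p / (1 - p)) / (1 + a)" unfolding \<sigma>a odds ..
        finally have "1 / (1 + \<sigma> * \<kappa> / (n * (1 + \<sigma> / real N))) = 1 / (1 + a * (p / (1 - p)) / (1 + a))" by simp
        also have "\<dots> = (1 - p) / (1 - p * b)"
          using a p by (simp add: b_def divide_simps) (simp add: algebra_simps)
        finally have "lim = (1 - p) / (1 - p * b) * b ^ d"
          unfolding lim_def \<sigma>a by (simp add: d_def b_def)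
        then show ?thesis by simp
      qed
      finally show ?thesis using conv by simp
    qed
  qed
qed

end
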